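(* Let $X,Y$ be random variables with values in finite sets $\mathcal X,\mathcal Y$, let $f_A:\mathcal X\times\mathcal Y\to\mathcal Z_A$, $f_B:\mathcal X\times\mathcal Y\to\mathcal Z_B$ be functions into finite sets, let $t\ge1$, and let $U^1,\dots,U^t$ be binary random variables, jointly distributed with $(X,Y)$, such that for every $i\in\{1,\dots,t\}$ the Markov chain $U^i\to(X,U^{1:i-1})\to Y$ holds if $i$ is odd and the Markov chain $U^i\to(Y,U^{1:i-1})\to X$ holds if $i$ is even, and such that $$H(f_A(X,Y)\mid X,U^{1:t})=0,\qquad H(f_B(X,Y)\mid Y,U^{1:t})=0 .$$ Let $0<\beta_7<\beta<1/2$. For $N=2^n$ let $\mathbf U_A^{1:t}=(\bar U_A^1,\dots,\bar U_A^t)$ and $\mathbf U_B^{1:t}=(\bar U_B^1,\dots,\bar U_B^t)$ be the sequences formed by Terminals A and B in the $t$-round protocol described in the context (with $\delta_N=2^{-N^\beta}$). Write $f_A(\bar X,\bar Y)=(f_A(X(k),Y(k)))_{k=1}^N$ and similarly $f_B(\bar X,\bar Y)$. Then there exist $\tilde Z_A^{1:N}\in\mathcal Z_A^N$, a function of $(\bar X,\mathbf U_A^{1:t})$, and $\tilde Z_B^{1:N}\in\mathcal Z_B^N$, a function of $(\bar Y,\mathbf U_B^{1:t})$, such that, as $N\to\infty$, $$\Pr\{\tilde Z_A^{1:N}=f_A(\bar X,\bar Y)\}=1-O(2^{-N^{\beta_7}}),\qquad \Pr\{\tilde Z_B^{1:N}=f_B(\bar X,\bar Y)\}=1-O(2^{-N^{\beta_7}}).$$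 Moreover, the number of operations needed to compute $\tilde Z_A^{1:N}$ and $\tilde Z_B^{1:N}$ from these arguments is linear in the blocklength $N$.
   Context: Polarization notation. $N=2^n$, $n\in\mathbb N$; $[N]=\{1,\dots,N\}$; $\delta_N=2^{-N^\beta}$. A bar denotes an $N$-vector, $w^{1:k}=(w^1,\dots,w^k)$, and $U^{1:k}=(U^1,\dots,U^k)$. $G_N=B_NF^{\otimes n}$ over $\mathbb F_2$, where $F=\begin{pmatrix}1&0\\1&1\end{pmatrix}$, $\otimes$ is the Kronecker product and $B_N$ is the $N\times N$ bit-reversal permutation matrix. For a binary random variable $T$ and a discrete random variable $V$, $Z(T|V)=2\sum_{v}P_V(v)\sqrt{P_{T|V}(0|v)P_{T|V}(1|v)}$. For a binary $U$ and a discrete $W$ with a given joint law, let $(\bar U,\bar W)$ be $N$ i.i.d. copies of $(U,W)$ and $\bar V=\bar UG_N$; put $\mathcal L_U=\{i\in[N]:Z(V^i|V^{1:i-1})\le\delta_N\}$, $\mathcal L_{U|W}=\{i\in[N]:Z(V^i|V^{1:i-1},\bar W)\le\delta_N\}$, $\mathcal H_{U|W}=\{i\in[N]:Z(V^i|V^{1:i-1},\bar W)\ge1-\delta_N\}$. The superscript $c$ is complement in $[N]$. Ideal distribution. $P$ denotes the law of $(\bar X,\bar Y,\bar U^1,\dots,\bar U^t,\bar V^1,\dots,\bar V^t)$, where $(\bar X,\bar Y,\bar U^1,\dots,\bar U^t)$ are $N$ i.i.d. copies of $(X,Y,U^1,\dots,U^t)$ and $\bar V^\ell=\bar U^\ell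 G_N$; its marginals and conditionals are also denoted $P$ (conditional laws given zero-probability events are fixed arbitrarily). Protocol. Terminal A observes $\bar X$, Terminal B observes $\bar Y$, where $(\bar X,\bar Y)$ are $N$ i.i.d. copies of $(X,Y)$. In round $\ell=1,\dots,t$ the transmitter $S$ is A if $\ell$ is odd and B if $\ell$ is even; the receiver $R$ is the other terminal. Put $W_A=X$, $W_B=Y$ and $\mathcal F_r^\ell=\mathcal L_{U^\ell}^c\cap\mathcal H_{U^\ell|(W_S,U^{1:\ell-1})}$, $\mathcal F_d^\ell=\mathcal L_{U^\ell}$, $\mathcal I^\ell=\mathcal L_{U^\ell}^c\cap\mathcal H^c_{U^\ell|(W_S,U^{1:\ell-1})}$, $\mathcal I'^\ell=\mathcal I^\ell\setminus(\mathcal L^c_{U^\ell}\cap\mathcal L_{U^\ell|(W_R,U^{1:\ell-1})})$. The transmitter generates $\bar v_S^\ell$ successively for $j=1,\dots,N$: if $j\in\mathcal F_r^\ell$, $(v_S^\ell)^j$ is a uniform bit; if $j\in\mathcal F_d^\ell$, it is sampled from $P_{(V^\ell)^j|(V^\ell)^{1:j-1}}(\cdot|(v_S^\ell)^{1:j-1})$; if $j\in\mathcal I^\ell$, it is sampled from $P_{(V^\ell)^j|(V^\ell)^{1:j-1},\bar W_S,\bar U^1,\dots,\bar U^{\ell-1}}(\cdot|(v_S^\ell)^{1:j-1},\bar w_S,\bar u_S^1,\dots,\bar u_S^{\ell-1})$. It sends the bits $(v_S^\ell)^j$, $j\in\mathcal I'^\ell$. The receiver sets $(v_R^\ell)^j=(v_S^\ell)^j$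 for $j\in\mathcal I'^\ell$; for $j\in\mathcal F_r^\ell$ it uses the same uniform bit as the transmitter (shared randomness); for $j\in\mathcal F_d^\ell$ it samples from $P_{(V^\ell)^j|(V^\ell)^{1:j-1}}(\cdot|(v_R^\ell)^{1:j-1})$; for $j\in\mathcal I^\ell\setminus\mathcal I'^\ell$ it samples from $P_{(V^\ell)^j|(V^\ell)^{1:j-1},\bar W_R,\bar U^1,\dots,\bar U^{\ell-1}}(\cdot|(v_R^\ell)^{1:j-1},\bar w_R,\bar u_R^1,\dots,\bar u_R^{\ell-1})$. The private samplings of the terminals use independent randomness, and shared bits are independent of everything else. Finally $\bar u_A^\ell=\bar v_A^\ell G_N$, $\bar u_B^\ell=\bar v_B^\ell G_N$. The constants in $O(\cdot)$ do not depend on $N$; the distribution of $(X,Y,U^{1:t})$ and $t$ are fixed. *)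

theory Defs
  imports
    "HOL-Probability.Probability"
    "HOL-Library.Landau_Symbols"
    "HOL-Library.Z2"
    "Jordan_Normal_Form.Matrix"
begin

section \<open>Probabilistic notions\<close>

text \<open>
  All random variables are functions on the sample space of a discrete law
  \<open>M :: 'w pmf\<close>; binary ones take values in \<^typ>\<open>bit\<close>, the field with two elements.
\<close>

definition markov_chain :: "'w pmf \<Rightarrow> ('w \<Rightarrow> 'a) \<Rightarrow> ('w \<Rightarrow> 'b) \<Rightarrow> ('w \<Rightarrow> 'c) \<Rightarrow> bool" where
  "markov_chain M T V W \<longleftrightarrow>
     (\<forall>a b c. \<P>(\<omega> in M. T \<omega> = a \<and> V \<omega> = b) > 0 \<longrightarrow>
        \<P>(\<omega> in M. W \<omega> = c \<bar> T \<omega> = a \<and> V \<omega> = b) = \<P>(\<omega> in M. W \<omega> = c \<bar> V \<omega> = b))"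

text \<open>
  \<open>H(T | V)\<close> in bits, for random variables of finite range. The library abbreviation is only
  available inside the locale \<^locale>\<open>information_space\<close>.
\<close>

definition cond_entropy :: "'w pmf \<Rightarrow> ('w \<Rightarrow> 'a) \<Rightarrow> ('w \<Rightarrow> 'b) \<Rightarrow> real" where
  "cond_entropy M T V =
     prob_space.conditional_entropy (measure_pmf M) 2
       (count_space (range T)) (count_space (range V)) T V"

definition bhattacharyya :: "'w pmf \<Rightarrow> ('w \<Rightarrow> bit) \<Rightarrow> ('w \<Rightarrow> 'b) \<Rightarrow> real" where
  "bhattacharyya M T V =
     2 * (\<Sum>\<^sub>\<infinity>v\<in>UNIV. \<P>(\<omega> in M. V \<omega> = v) *
        sqrt (\<P>(\<omega> in M. T \<omega> = 0 \<bar> V \<omega> = v) * \<P>(\<omega> in M. T \<omega> = 1 \<bar> V \<omega> = v)))"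

text \<open>
  The conditional law \<open>P\<^bsub>T|V\<^esub>(\<cdot>|v)\<close>. Conditioning on an event of probability zero
  yields the arbitrary law \<open>null v\<close>.
\<close>

definition cond_law :: "('b \<Rightarrow> 'a pmf) \<Rightarrow> 'w pmf \<Rightarrow> ('w \<Rightarrow> 'a) \<Rightarrow> ('w \<Rightarrow> 'b) \<Rightarrow> 'b \<Rightarrow> 'a pmf" where
  "cond_law null M T V v =
     (if \<P>(\<omega> in M. V \<omega> = v) = 0 then null v else map_pmf T (cond_pmf M {\<omega>. V \<omega> = v}))"


section \<open>The polar transform\<close>

definition kron_mat :: "'a::semiring_0 mat \<Rightarrow> 'a mat \<Rightarrow> 'a mat" where
  "kron_mat A B =
     mat (dim_row A * dim_row B) (dim_col A * dim_col B)
       (\<lambda>(i, j). A $$ (i div dim_row B, j div dim_col B) * B $$ (i mod dim_row B, j mod dim_col B))"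

primrec kron_power :: "'a::semiring_1 mat \<Rightarrow> nat \<Rightarrow> 'a mat" where
  "kron_power A 0 = 1\<^sub>m 1"
| "kron_power A (Suc n) = kron_mat A (kron_power A n)"

definition bit_reversal :: "nat \<Rightarrow> nat \<Rightarrow> nat" where
  "bit_reversal n i = (\<Sum>k<n. (i div 2 ^ k mod 2) * 2 ^ (n - 1 - k))"

definition polar_mat :: "nat \<Rightarrow> bit mat" where
  "polar_mat n =
     mat (2 ^ n) (2 ^ n) (\<lambda>(i, j). if j = bit_reversal n i then 1 else 0) *
     kron_power (mat_of_rows_list 2 [[1, 0], [1, 1]]) n"

definition polar_transform :: "nat \<Rightarrow> bit list \<Rightarrow> bit list" where
  "polar_transform n u =
     map (\<lambda>j. scalar_prod (vec_of_list u) (col (polar_mat n) j)) [0..<2 ^ n]"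


section \<open>The protocol\<close>

datatype terminal = TA | TB

fun transmitter :: "nat \<Rightarrow> terminal" where
  "transmitter l = (if odd l then TA else TB)"

fun receiver :: "nat \<Rightarrow> terminal" where
  "receiver l = (if odd l then TB else TA)"

text \<open>Draws a list entry by entry; \<open>f j vs\<close> is the law of entry \<open>j\<close> given the first \<open>j\<close> entries.\<close>

primrec successive :: "(nat \<Rightarrow> 'a list \<Rightarrow> 'a pmf) \<Rightarrow> nat \<Rightarrow> 'a list pmf" where
  "successive f 0 = return_pmf []"
| "successive f (Suc j) =
     do {vs \<leftarrow> successive f j; b \<leftarrow> f j vs; return_pmf (vs @ [b])}"

definition delta :: "real \<Rightarrow> nat \<Rightarrow> real" where
  "delta \<beta> n = 2 powr - ((2 ^ n) powr \<beta>)"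

text \<open>
  Blocks of length \<open>2 ^ n\<close> are lists, so positions run from \<open>0\<close> to \<open>2 ^ n - 1\<close> and
  the entries strictly before position \<open>j\<close> of \<open>v\<close> are \<open>take j v\<close>. Rounds are numbered from \<open>1\<close>.
  The parameters \<open>null_d n l j\<close> and \<open>null_i n l j\<close> are the arbitrary conditional laws, given
  zero-probability events, of bit \<open>j\<close> of the polarized block of round \<open>l\<close>.
\<close>

locale interaction =
  fixes M :: "'w pmf"
    and X :: "'w \<Rightarrow> 'x"
    and Y :: "'w \<Rightarrow> 'y"
    and U :: "nat \<Rightarrow> 'w \<Rightarrow> bit"
    and \<beta> :: real
    and null_d :: "nat \<Rightarrow> nat \<Rightarrow> nat \<Rightarrow> bit list \<Rightarrow> bit pmf"
    and null_i :: "nat \<Rightarrow> nat \<Rightarrow> nat \<Rightarrow> bit list \<times> ('x + 'y) list \<times> bit list list \<Rightarrow> bit pmf"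
begin

text \<open>The observation of a terminal; the sum type lets both terminals be treated uniformly.\<close>

definition obs :: "terminal \<Rightarrow> 'w \<Rightarrow> 'x + 'y" where
  "obs s \<omega> = (case s of TA \<Rightarrow> Inl (X \<omega>) | TB \<Rightarrow> Inr (Y \<omega>))"

definition Us :: "nat \<Rightarrow> 'w \<Rightarrow> bit list" where
  "Us l \<omega> = map (\<lambda>i. U i \<omega>) [1..<Suc l]"

definition ideal :: "nat \<Rightarrow> 'w list pmf" where
  "ideal n = replicate_pmf (2 ^ n) M"

definition V :: "nat \<Rightarrow> nat \<Rightarrow> 'w list \<Rightarrow> bit list" where
  "V n l ws = polar_transform n (map (U l) ws)"

definition U_blocks :: "nat \<Rightarrow> 'w list \<Rightarrow> bit list list" where
  "U_blocks l ws = map (\<lambda>i. map (U i) ws) [1..<Suc l]"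

definition low :: "nat \<Rightarrow> nat \<Rightarrow> nat set" where
  "low n l =
     {j. j < 2 ^ n \<and>
         bhattacharyya (ideal n) (\<lambda>ws. V n l ws ! j) (\<lambda>ws. take j (V n l ws)) \<le> delta \<beta> n}"

definition low_given :: "nat \<Rightarrow> nat \<Rightarrow> ('w \<Rightarrow> 'b) \<Rightarrow> nat set" where
  "low_given n l W =
     {j. j < 2 ^ n \<and>
         bhattacharyya (ideal n) (\<lambda>ws. V n l ws ! j) (\<lambda>ws. (take j (V n l ws), map W ws))
           \<le> delta \<beta> n}"

definition high_given :: "nat \<Rightarrow> nat \<Rightarrow> ('w \<Rightarrow> 'b) \<Rightarrow> nat set" where
  "high_given n l W =
     {j. j < 2 ^ n \<and>
         bhattacharyya (ideal n) (\<lambda>ws. V n l ws ! j) (\<lambda>ws. (take j (V n l ws), map W ws))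
           \<ge> 1 - delta \<beta> n}"

definition side_info :: "terminal \<Rightarrow> nat \<Rightarrow> 'w \<Rightarrow> ('x + 'y) \<times> bit list" where
  "side_info s l \<omega> = (obs s \<omega>, Us (l - 1) \<omega>)"

definition F_r :: "nat \<Rightarrow> nat \<Rightarrow> nat set" where
  "F_r n l = ({..<2 ^ n} - low n l) \<inter> high_given n l (side_info (transmitter l) l)"

definition F_d :: "nat \<Rightarrow> nat \<Rightarrow> nat set" where
  "F_d n l = low n l"

definition I_set :: "nat \<Rightarrow> nat \<Rightarrow> nat set" where
  "I_set n l =
     ({..<2 ^ n} - low n l) \<inter> ({..<2 ^ n} - high_given n l (side_info (transmitter l) l))"

definition I_sent :: "nat \<Rightarrow> nat \<Rightarrow> nat set" where
  "I_sent n l =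
     I_set n l - (({..<2 ^ n} - low n l) \<inter> low_given n l (side_info (receiver l) l))"

definition law_d :: "nat \<Rightarrow> nat \<Rightarrow> nat \<Rightarrow> bit list \<Rightarrow> bit pmf" where
  "law_d n l j =
     cond_law (null_d n l j) (ideal n) (\<lambda>ws. V n l ws ! j) (\<lambda>ws. take j (V n l ws))"

definition law_i ::
  "nat \<Rightarrow> nat \<Rightarrow> terminal \<Rightarrow> nat \<Rightarrow> bit list \<times> ('x + 'y) list \<times> bit list list \<Rightarrow> bit pmf" where
  "law_i n l s j =
     cond_law (null_i n l j) (ideal n) (\<lambda>ws. V n l ws ! j)
       (\<lambda>ws. (take j (V n l ws), map (obs s) ws, U_blocks (l - 1) ws))"

text \<open>
  In the next two definitions, \<open>w\<close> is the observed block of the terminal and \<open>us\<close> the list of the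
  blocks it formed in the earlier rounds. The sets \<^term>\<open>F_r n l\<close>, \<^term>\<open>F_d n l\<close> and
  \<^term>\<open>I_set n l\<close> partition the positions. The shared random bits are the entries of
  the transmitter's list \<open>v\<close> in \<^term>\<open>F_r n l\<close>, which the receiver copies.
\<close>

definition transmitter_bit ::
  "nat \<Rightarrow> nat \<Rightarrow> ('x + 'y) list \<Rightarrow> bit list list \<Rightarrow> nat \<Rightarrow> bit list \<Rightarrow> bit pmf" where
  "transmitter_bit n l w us j vs =
     (if j \<in> F_r n l then pmf_of_set {0, 1}
      else if j \<in> F_d n l then law_d n l j vs
      else law_i n l (transmitter l) j (vs, w, us))"

definition receiver_bit ::
  "nat \<Rightarrow> nat \<Rightarrow> ('x + 'y) list \<Rightarrow> bit list list \<Rightarrow> bit list \<Rightarrow> nat \<Rightarrow> bit list \<Rightarrow> bit pmf" where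
  "receiver_bit n l w us v j vs =
     (if j \<in> F_r n l \<union> I_sent n l then return_pmf (v ! j)
      else if j \<in> F_d n l then law_d n l j vs
      else law_i n l (receiver l) j (vs, w, us))"

text \<open>
  The state \<open>us\<close> assigns to each terminal the list of the \<open>u\<close>-blocks that it has formed so far.
\<close>

definition round_step ::
  "nat \<Rightarrow> (terminal \<Rightarrow> ('x + 'y) list) \<Rightarrow> nat \<Rightarrow> (terminal \<Rightarrow> bit list list)
     \<Rightarrow> (terminal \<Rightarrow> bit list list) pmf" where
  "round_step n w l us =
     (let S = transmitter l; R = receiver l in
      do {
        vS \<leftarrow> successive (transmitter_bit n l (w S) (us S)) (2 ^ n);
        vR \<leftarrow> successive (receiver_bit n l (w R) (us R) vS) (2 ^ n);
        return_pmf (us(S := us S @ [polar_transform n vS], R := us R @ [polar_transform n vR]))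
      })"

primrec rounds ::
  "nat \<Rightarrow> (terminal \<Rightarrow> ('x + 'y) list) \<Rightarrow> nat \<Rightarrow> (terminal \<Rightarrow> bit list list) pmf" where
  "rounds n w 0 = return_pmf (\<lambda>_. [])"
| "rounds n w (Suc l) = bind_pmf (rounds n w l) (round_step n w (Suc l))"

text \<open>
  The joint law of the two observed blocks and of the sequences formed by the two terminals
  in \<open>t\<close> rounds.
\<close>

definition protocol ::
  "nat \<Rightarrow> nat \<Rightarrow> ('x list \<times> 'y list \<times> bit list list \<times> bit list list) pmf" where
  "protocol n t =
     do {
       ws \<leftarrow> ideal n;
       us \<leftarrow> rounds n (\<lambda>s. map (obs s) ws) t;
       return_pmf (map X ws, map Y ws, us TA, us TB)
     }"

end


section \<open>Linear-time computability\<close>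

text \<open>
  Operations are counted as steps of a deterministic multitape Turing machine. One machine, with
  finitely many states and tape symbols and a fixed number of tapes, has to handle all blocklengths.
  The tapes are two-way infinite. A transition reads the symbols under all heads and specifies
  the new state and, for each tape, the symbol to write and the head movement.
\<close>

datatype ('a, 'z) symbol = Blank | Src 'a | Bit bit | Out 'z | Aux nat

record ('a, 'z) machine =
  tapes :: nat
  states :: "nat set"
  start :: nat
  halt :: nat
  symbols :: "('a, 'z) symbol set"
  trans :: "nat \<Rightarrow> ('a, 'z) symbol list \<Rightarrow> nat \<times> (('a, 'z) symbol \<times> int) list"

definition wf_machine :: "('a, 'z) machine \<Rightarrow> bool" where
  "wf_machine m \<longleftrightarrow>
     finite (states m) \<and> start m \<in> states m \<and> halt m \<in> states m \<and>
     finite (symbols m) \<and> Blank \<in> symbols m \<and> range Src \<subseteq> symbols m \<and> range Bit \<subseteq> symbols m \<and>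
     (\<forall>q\<in>states m. \<forall>ss. length ss = tapes m \<and> set ss \<subseteq> symbols m \<longrightarrow>
        fst (trans m q ss) \<in> states m \<and>
        length (snd (trans m q ss)) = tapes m \<and>
        set (snd (trans m q ss)) \<subseteq> symbols m \<times> {-1, 0, 1})"

text \<open>A configuration consists of the state and, for each tape, its contents and head position.\<close>

type_synonym ('a, 'z) config = "nat \<times> ((int \<Rightarrow> ('a, 'z) symbol) \<times> int) list"

definition step :: "('a, 'z) machine \<Rightarrow> ('a, 'z) config \<Rightarrow> ('a, 'z) config" where
  "step m c =
     (case c of (q, ts) \<Rightarrow>
        if q = halt m then c
        else (case trans m q (map (\<lambda>(f, h). f h) ts) of (q', acts) \<Rightarrow>
          (q', map2 (\<lambda>(f, h) (s, d). (f(h := s), h + d)) ts acts)))"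

definition contents :: "('a, 'z) symbol list \<Rightarrow> int \<Rightarrow> ('a, 'z) symbol" where
  "contents ss i = (if 0 \<le> i \<and> i < int (length ss) then ss ! nat i else Blank)"

text \<open>
  The inputs are placed on the first tapes, one per tape; the output has to appear on the tape
  that follows them. As a halted machine no longer moves, the machine reaches its halting state
  after at most \<open>k\<close> steps.
\<close>

definition computes_within ::
  "('a, 'z) machine \<Rightarrow> nat \<Rightarrow> ('a, 'z) symbol list list \<Rightarrow> ('a, 'z) symbol list \<Rightarrow> bool" where
  "computes_within m k ins out \<longleftrightarrow>
     length ins < tapes m \<and>
     (let c0 = (start m, map (\<lambda>ss. (contents ss, 0)) (ins @ replicate (tapes m - length ins) []));
          (q, ts) = (step m ^^ k) c0
      in q = halt m \<and> fst (ts ! length ins) = contents out)"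

text \<open>
  \<open>g\<close> maps a source block and \<open>t\<close> binary blocks, all of the same length \<open>N = 2 ^ n\<close>, to
  an output block of length \<open>N\<close>, with a number of operations linear in \<open>N\<close>.
\<close>

definition linear_time_block_map ::
  "nat \<Rightarrow> ('a list \<Rightarrow> bit list list \<Rightarrow> 'z list) \<Rightarrow> bool" where
  "linear_time_block_map t g \<longleftrightarrow>
     (\<exists>(m :: ('a, 'z) machine) (c :: nat). wf_machine m \<and>
        (\<forall>n xs us. length xs = 2 ^ n \<and> length us = t \<and> (\<forall>u\<in>set us. length u = 2 ^ n) \<longrightarrow>
           length (g xs us) = 2 ^ n \<and>
           computes_within m (c * 2 ^ n) (map Src xs # map (map Bit) us) (map Out (g xs us))))"

end

theory Submission
  imports Defs "HOL-Real_Asymp.Real_Asymp"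
begin

text \<open>
  Call two laws \<open>e\<close>-close if they differ by at most \<open>e\<close> in total variation. In round \<open>l\<close>, feed the
  terminals with ideal blocks and replace the sampled bits by the ideal ones one at a time. A bit in
  \<open>F_r\<close> costs \<open>sqrt \<delta>\<close>, since its conditional law has Bhattacharyya parameter at least \<open>1 - \<delta>\<close> and is
  therefore almost uniform; a bit sampled given a variable for which the parameter is at most
  \<open>\<delta>\<close> costs \<open>\<delta>\<close>, since it is almost determined; the remaining transmitter bits cost nothing, because
  by the Markov chain the other terminal's observation does not change their conditional law. So
  after \<open>t\<close> rounds both terminals hold the ideal blocks up to a distance \<open>2 t N sqrt \<delta>\<close>. The polar
  transform enters only as an involution, and polarization itself is not needed: it governs the rate,
  not the error. For the ideal blocks, zero conditional entropy makes the function values symbolwise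
  functions of what each terminal holds, and a machine computes them in one pass over its tapes.
\<close>

section \<open>Statistical distance of discrete laws\<close>

lemma expectation_bind_pmf:
  fixes h :: "'b \<Rightarrow> real"
  assumes "\<And>x. \<bar>h x\<bar> \<le> B"
  shows "measure_pmf.expectation (bind_pmf p f) h =
    measure_pmf.expectation p (\<lambda>x. measure_pmf.expectation (f x) h)"
  unfolding measure_pmf_bind
  by (rule integral_bind[where K = "count_space UNIV" and B = B and B' = 1])
     (use assms in \<open>auto simp: measure_pmf.emeasure_le_1 measure_pmf_in_subprob_algebra\<close>)

text \<open>
  One-sided, but symmetric by passing from \<open>h\<close> to \<open>1 - h\<close>. Test functions instead of events
  make the data processing inequality immediate.
\<close>

definition close :: "real \<Rightarrow> 'a pmf \<Rightarrow> 'a pmf \<Rightarrow> bool" where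
  "close e p q \<longleftrightarrow> (\<forall>h :: 'a \<Rightarrow> real. (\<forall>x. 0 \<le> h x \<and> h x \<le> 1) \<longrightarrow>
     measure_pmf.expectation p h \<le> measure_pmf.expectation q h + e)"

lemma close_refl: "close 0 p p"
  by (simp add: close_def)

lemma close_mono: "close e p q \<Longrightarrow> e \<le> e' \<Longrightarrow> close e' p q"
  unfolding close_def by (meson add_left_mono order_trans)

lemma close_trans: "close e p q \<Longrightarrow> close e' q r \<Longrightarrow> close (e + e') p r"
  unfolding close_def by (metis (no_types, lifting) add.assoc add.commute add_left_mono order_trans)

lemma expectation_unit_interval:
  fixes h :: "'a \<Rightarrow> real"
  assumes "\<forall>x. 0 \<le> h x \<and> h x \<le> 1"
  shows "0 \<le> measure_pmf.expectation p h \<and> measure_pmf.expectation p h \<le> 1"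
proof
  show "0 \<le> measure_pmf.expectation p h"
    using assms by (simp add: integral_nonneg_AE)
  show "measure_pmf.expectation p h \<le> 1"
    using assms by (intro measure_pmf.integral_le_const measure_pmf.integrable_const_bound[where B = 1]) auto
qed

lemma close_bind:
  assumes "close e p q"
  shows "close e (bind_pmf p f) (bind_pmf q f)"
  unfolding close_def
proof (intro allI impI)
  fix h :: "'b \<Rightarrow> real"
  assume h: "\<forall>x. 0 \<le> h x \<and> h x \<le> 1"
  then have "\<And>x. \<bar>h x\<bar> \<le> 1" by auto
  then show "measure_pmf.expectation (bind_pmf p f) h \<le> measure_pmf.expectation (bind_pmf q f) h + e"
    using assms expectation_unit_interval[OF h]
    by (simp add: expectation_bind_pmf[where B = 1] close_def)
qed

lemma close_map: "close e p q \<Longrightarrow> close e (map_pmf f p) (map_pmf f q)"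
  unfolding map_pmf_def by (rule close_bind)

text \<open>The error \<open>d x\<close> may depend on the conditioning value and only its mean
  counts. This is how Bhattacharyya parameters, themselves averages over the conditioning, come
  in.\<close>

lemma close_bind_cong:
  fixes f g :: "'a \<Rightarrow> 'b pmf"
  assumes le: "\<And>h x. \<forall>y. 0 \<le> h y \<and> h y \<le> 1 \<Longrightarrow> x \<in> set_pmf p \<Longrightarrow>
      measure_pmf.expectation (f x) h \<le> measure_pmf.expectation (g x) h + d x"
    and d: "integrable (measure_pmf p) d" "measure_pmf.expectation p d \<le> e"
  shows "close e (bind_pmf p f) (bind_pmf p g)"
  unfolding close_def
proof (intro allI impI)
  fix h :: "'b \<Rightarrow> real"
  assume h: "\<forall>x. 0 \<le> h x \<and> h x \<le> 1"
  then have B: "\<And>x. \<bar>h x\<bar> \<le> 1" by auto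
  have int: "integrable (measure_pmf p) (\<lambda>x. measure_pmf.expectation (k x) h)" for k :: "'a \<Rightarrow> 'b pmf"
    using expectation_unit_interval[OF h]
    by (intro measure_pmf.integrable_const_bound[where B = 1]) auto
  have "measure_pmf.expectation p (\<lambda>x. measure_pmf.expectation (f x) h) \<le>
      measure_pmf.expectation p (\<lambda>x. measure_pmf.expectation (g x) h + d x)"
    using int d le[OF h] by (intro integral_mono_AE) (auto simp: AE_measure_pmf_iff)
  also have "\<dots> \<le> measure_pmf.expectation p (\<lambda>x. measure_pmf.expectation (g x) h) + e"
    using int d by simp
  finally show "measure_pmf.expectation (bind_pmf p f) h \<le> measure_pmf.expectation (bind_pmf p g) h + e"
    using B by (simp add: expectation_bind_pmf[where B = 1])
qed

lemma measure_close:
  assumes "close e p q"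
  shows "measure_pmf.prob p A \<le> measure_pmf.prob q A + e"
proof -
  have "measure_pmf.expectation p (indicat_real A) \<le> measure_pmf.expectation q (indicat_real A) + e"
    using assms unfolding close_def by (elim allE[of _ "indicat_real A"] impE) (auto simp: indicator_def)
  then show ?thesis by simp
qed

text \<open>Hybrid argument: bit \<open>j\<close> is compared with the ideal one behind an ideal
  prefix, and the \<open>n\<close> single-bit errors add up. The context \<open>C w\<close> is
  carried along because the drawn list has to keep its joint law with it.\<close>

lemma close_successive:
  assumes "\<And>w. w \<in> set_pmf Q \<Longrightarrow> n \<le> length (v w)"
    and step: "\<And>j. j < n \<Longrightarrow>
      close e
        (bind_pmf Q (\<lambda>w. map_pmf (\<lambda>b. (C w, take j (v w), b)) (f (C w) j (take j (v w)))))
        (map_pmf (\<lambda>w. (C w, take j (v w), v w ! j)) Q)"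
  shows "close (real n * e)
    (bind_pmf Q (\<lambda>w. map_pmf (\<lambda>vs. (C w, vs)) (successive (f (C w)) n)))
    (map_pmf (\<lambda>w. (C w, take n (v w))) Q)"
  using assms
proof (induction n)
  case 0
  then show ?case by (simp add: map_pmf_def[of "\<lambda>w. (C w, [])"] close_refl)
next
  case (Suc n)
  \<comment> \<open>Appending the next bit is a kernel acting on context and prefix alone, so it
    does not increase the error of the first \<open>n\<close> bits.\<close>
  define ext where "ext = (\<lambda>(c, vs). map_pmf (\<lambda>b. (c, vs @ [b])) (f c n vs))"
  have IH: "close (real n * e)
      (bind_pmf (bind_pmf Q (\<lambda>w. map_pmf (\<lambda>vs. (C w, vs)) (successive (f (C w)) n))) ext)
      (bind_pmf (map_pmf (\<lambda>w. (C w, take n (v w))) Q) ext)"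
    using Suc.prems by (intro close_bind Suc.IH) (auto intro: Suc_leD)
  have eq1: "bind_pmf (bind_pmf Q (\<lambda>w. map_pmf (\<lambda>vs. (C w, vs)) (successive (f (C w)) n))) ext =
      bind_pmf Q (\<lambda>w. map_pmf (\<lambda>vs. (C w, vs)) (successive (f (C w)) (Suc n)))"
    by (simp add: ext_def map_pmf_def bind_assoc_pmf bind_return_pmf)
  have eq2: "bind_pmf (map_pmf (\<lambda>w. (C w, take n (v w))) Q) ext =
      map_pmf (\<lambda>(c, vs, b). (c, vs @ [b]))
        (bind_pmf Q (\<lambda>w. map_pmf (\<lambda>b. (C w, take n (v w), b)) (f (C w) n (take n (v w)))))"
    by (simp add: ext_def map_pmf_def bind_assoc_pmf bind_return_pmf)
  have eq3: "map_pmf (\<lambda>w. (C w, take (Suc n) (v w))) Q =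
      map_pmf (\<lambda>(c, vs, b). (c, vs @ [b])) (map_pmf (\<lambda>w. (C w, take n (v w), v w ! n)) Q)"
    unfolding map_pmf_comp
    by (rule map_pmf_cong) (use Suc.prems(1) in \<open>auto simp: take_Suc_conv_app_nth Suc_le_eq\<close>)
  have "close (real n * e + e)
      (bind_pmf Q (\<lambda>w. map_pmf (\<lambda>vs. (C w, vs)) (successive (f (C w)) (Suc n))))
      (map_pmf (\<lambda>w. (C w, take (Suc n) (v w))) Q)"
    using close_trans[OF IH[unfolded eq1 eq2] close_map[OF Suc.prems(2)[of n]]] by (simp only: eq3 lessI)
  then show ?case by (simp add: algebra_simps)
qed

section \<open>Conditional laws and conditional independence\<close>

lemma pmf_bind_kernel:
  "pmf (bind_pmf M (\<lambda>w. map_pmf (Pair (A w)) (R (A w)))) (a, t) = pmf (map_pmf A M) a * pmf (R a) t"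
proof -
  have "pmf (map_pmf (Pair (A w)) (R (A w))) (a, t) = indicat_real {w. A w = a} w * pmf (R a) t" for w
  proof (cases "A w = a")
    case True
    have "inj (Pair a)" by (simp add: inj_on_def)
    then show ?thesis using True pmf_map_inj'[of "Pair a" "R a" t] by simp
  next
    case False
    then have "(a, t) \<notin> set_pmf (map_pmf (Pair (A w)) (R (A w)))" by auto
    then show ?thesis using False by (simp add: pmf_eq_0_set_pmf)
  qed
  then have "pmf (bind_pmf M (\<lambda>w. map_pmf (Pair (A w)) (R (A w)))) (a, t) =
      measure_pmf.prob M {w. A w = a} * pmf (R a) t"
    by (simp add: pmf_bind)
  then show ?thesis by (simp add: pmf_map vimage_def)
qed

lemma pmf_cond_law:
  assumes "measure_pmf.prob M {w. A w = a} \<noteq> 0"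
  shows "pmf (cond_law null M T A a) t =
    measure_pmf.prob M {w. T w = t \<and> A w = a} / measure_pmf.prob M {w. A w = a}"
proof -
  have ne: "set_pmf M \<inter> {w. A w = a} \<noteq> {}"
    using assms measure_pmf_zero_iff by blast
  have "measure_pmf.prob (cond_pmf M {w. A w = a}) (T -` {t}) =
      measure_pmf.prob M {w. T w = t \<and> A w = a} / measure_pmf.prob M {w. A w = a}"
    by (subst cond_pmf.rep_eq[OF ne])
       (simp add: measure_pmf.emeasure_eq_measure measure_uniform_measure assms Int_def vimage_def conj_commute)
  then show ?thesis using assms by (simp add: cond_law_def pmf_map)
qed

text \<open>Disintegration of a joint law. The law \<open>null\<close> enters only at values of
  probability zero, where both sides have no mass.\<close>

lemma map_pmf_eq_bind_cond_law:
  "map_pmf (\<lambda>w. (A w, T w)) M =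
    bind_pmf M (\<lambda>w. map_pmf (Pair (A w)) (cond_law null M T A (A w)))"
proof (rule pmf_eqI, clarify)
  fix a t
  have "pmf (map_pmf (\<lambda>w. (A w, T w)) M) (a, t) = measure_pmf.prob M {w. T w = t \<and> A w = a}"
    by (simp add: pmf_map vimage_def conj_commute)
  also have "\<dots> = measure_pmf.prob M {w. A w = a} * pmf (cond_law null M T A a) t"
  proof (cases "measure_pmf.prob M {w. A w = a} = 0")
    case True
    moreover have "measure_pmf.prob M {w. T w = t \<and> A w = a} \<le> measure_pmf.prob M {w. A w = a}"
      by (rule measure_pmf.finite_measure_mono) auto
    ultimately show ?thesis by (simp add: measure_le_0_iff)
  qed (simp add: pmf_cond_law)
  finally show "pmf (map_pmf (\<lambda>w. (A w, T w)) M) (a, t) =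
      pmf (bind_pmf M (\<lambda>w. map_pmf (Pair (A w)) (cond_law null M T A (A w)))) (a, t)"
    by (simp add: pmf_bind_kernel pmf_map vimage_def)
qed

text \<open>A disintegration is unique on the support: there the mass of \<open>A w\<close> is
  nonzero and can be cancelled.\<close>

lemma cond_law_eqI:
  assumes "map_pmf (\<lambda>w. (A w, T w)) M = bind_pmf M (\<lambda>w. map_pmf (Pair (A w)) (R (A w)))"
    and "w \<in> set_pmf M"
  shows "cond_law null M T A (A w) = R (A w)"
proof (rule pmf_eqI)
  fix t
  have "pmf (map_pmf A M) (A w) \<noteq> 0"
    using assms(2) by (simp add: set_pmf_iff[symmetric])
  moreover have "pmf (map_pmf A M) (A w) * pmf (cond_law null M T A (A w)) t =
      pmf (map_pmf A M) (A w) * pmf (R (A w)) t"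
    using assms(1) unfolding map_pmf_eq_bind_cond_law[of A T M null]
    by (simp only: pmf_bind_kernel[symmetric])
  ultimately show "pmf (cond_law null M T A (A w)) t = pmf (R (A w)) t" by simp
qed

text \<open>Given \<open>A\<close>, the variable \<open>T\<close> is independent of \<open>C\<close> and has law \<open>R A\<close>.\<close>

definition cond_kernel ::
  "'w pmf \<Rightarrow> ('w \<Rightarrow> 'c) \<Rightarrow> ('w \<Rightarrow> 'a) \<Rightarrow> ('w \<Rightarrow> 't) \<Rightarrow> ('a \<Rightarrow> 't pmf) \<Rightarrow> bool" where
  "cond_kernel M C A T R \<longleftrightarrow>
     map_pmf (\<lambda>w. (C w, A w, T w)) M =
     bind_pmf M (\<lambda>w. map_pmf (\<lambda>v. (C w, A w, v)) (R (A w)))"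

lemma cond_kernel_map:
  assumes "cond_kernel M C A T R"
  shows "cond_kernel M C A (\<lambda>w. f (T w)) (\<lambda>a. map_pmf f (R a))"
  using arg_cong[OF assms[unfolded cond_kernel_def], of "map_pmf (\<lambda>(c, a, v). (c, a, f v))"]
  by (simp add: cond_kernel_def map_pmf_comp map_bind_pmf)

lemma cond_kernel_context:
  assumes "cond_kernel M C A T R" and "\<And>w. w \<in> set_pmf M \<Longrightarrow> C' w = f (C w) (A w)"
  shows "cond_kernel M C' A T R"
proof -
  have "map_pmf (\<lambda>w. (f (C w) (A w), A w, T w)) M =
      bind_pmf M (\<lambda>w. map_pmf (\<lambda>v. (f (C w) (A w), A w, v)) (R (A w)))"
    using arg_cong[OF assms(1)[unfolded cond_kernel_def], of "map_pmf (\<lambda>(c, a, v). (f c a, a, v))"]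
    by (simp add: map_pmf_comp map_bind_pmf)
  moreover have "map_pmf (\<lambda>w. (C' w, A w, T w)) M = map_pmf (\<lambda>w. (f (C w) (A w), A w, T w)) M"
    by (rule map_pmf_cong) (simp_all add: assms(2))
  moreover have "bind_pmf M (\<lambda>w. map_pmf (\<lambda>v. (C' w, A w, v)) (R (A w))) =
      bind_pmf M (\<lambda>w. map_pmf (\<lambda>v. (f (C w) (A w), A w, v)) (R (A w)))"
    by (rule bind_pmf_cong) (simp_all add: assms(2))
  ultimately show ?thesis by (simp only: cond_kernel_def)
qed

lemma cond_kernel_reindex:
  assumes "cond_kernel M C A T R"
    and "\<And>w. w \<in> set_pmf M \<Longrightarrow> B w = f (A w)" "\<And>w. w \<in> set_pmf M \<Longrightarrow> g (B w) = A w"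
  shows "cond_kernel M C B T (\<lambda>b. R (g b))"
proof -
  have "map_pmf (\<lambda>w. (C w, B w, T w)) M = map_pmf (\<lambda>(c, a, v). (c, f a, v)) (map_pmf (\<lambda>w. (C w, A w, T w)) M)"
    unfolding map_pmf_comp by (rule map_pmf_cong) (auto simp: assms(2))
  also have "\<dots> = bind_pmf M (\<lambda>w. map_pmf (\<lambda>v. (C w, f (A w), v)) (R (A w)))"
    by (simp add: assms(1)[unfolded cond_kernel_def] map_pmf_comp map_bind_pmf)
  also have "\<dots> = bind_pmf M (\<lambda>w. map_pmf (\<lambda>v. (C w, B w, v)) (R (g (B w))))"
    by (rule bind_pmf_cong) (simp_all add: assms(2)[symmetric] assms(3))
  finally show ?thesis by (simp add: cond_kernel_def)
qed

text \<open>The weak union rule of conditional independence: part of the drawn pair moves into the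
  condition. The new kernel conditions \<open>R a\<close> on its first component. With
  \<open>S\<close> a prefix of the polarized block and \<open>T\<close> the next bit, this is what
  successive sampling requires.\<close>

lemma cond_kernel_chain:
  fixes C :: "'w \<Rightarrow> 'c" and A :: "'w \<Rightarrow> 'a" and S :: "'w \<Rightarrow> 's" and T :: "'w \<Rightarrow> 't"
  assumes "cond_kernel M C A (\<lambda>w. (S w, T w)) R"
  shows "cond_kernel M C (\<lambda>w. (S w, A w)) T (\<lambda>(s, a). cond_law undefined (R a) snd fst s)"
proof -
  define K where "K = (\<lambda>(s, a). cond_law undefined (R a) snd fst s)"
  define k :: "'c \<times> 'a \<times> 's \<times> 't \<Rightarrow> ('c \<times> ('s \<times> 'a) \<times> 't) pmf"
    where "k = (\<lambda>(c, a, x). map_pmf (\<lambda>v. (c, (fst x, a), v)) (K (fst x, a)))"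
  have R: "R a = bind_pmf (R a) (\<lambda>x. map_pmf (Pair (fst x)) (K (fst x, a)))" for a
    using map_pmf_eq_bind_cond_law[of fst snd "R a" undefined] by (simp add: K_def)
  have "bind_pmf M (\<lambda>w. map_pmf (\<lambda>v. (C w, (S w, A w), v)) (K (S w, A w))) =
      bind_pmf (map_pmf (\<lambda>w. (C w, A w, S w, T w)) M) k"
    by (simp add: k_def bind_map_pmf)
  also have "\<dots> = bind_pmf M (\<lambda>w. map_pmf (\<lambda>x. (C w, (fst x, A w), snd x))
      (bind_pmf (R (A w)) (\<lambda>x. map_pmf (Pair (fst x)) (K (fst x, A w)))))"
    by (simp add: assms[unfolded cond_kernel_def] k_def map_pmf_comp map_bind_pmf bind_map_pmf bind_assoc_pmf)
  also have "\<dots> = map_pmf (\<lambda>(c, a, x). (c, (fst x, a), snd x)) (map_pmf (\<lambda>w. (C w, A w, S w, T w)) M)"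
    unfolding R[symmetric] assms[unfolded cond_kernel_def] by (simp add: map_pmf_comp map_bind_pmf)
  finally show ?thesis by (simp add: cond_kernel_def K_def map_pmf_comp)
qed

text \<open>By uniqueness of disintegrations, any kernel can be exchanged for the conditional law
  that the protocol samples from.\<close>

lemma cond_kernel_cond_law:
  assumes "cond_kernel M C A T R"
  shows "cond_kernel M C A T (cond_law null M T A)"
proof -
  have "map_pmf (\<lambda>w. (A w, T w)) M = bind_pmf M (\<lambda>w. map_pmf (Pair (A w)) (R (A w)))"
    using arg_cong[OF assms[unfolded cond_kernel_def], of "map_pmf snd"]
    by (simp add: map_pmf_comp map_bind_pmf)
  then have "bind_pmf M (\<lambda>w. map_pmf (\<lambda>v. (C w, A w, v)) (cond_law null M T A (A w))) =
      bind_pmf M (\<lambda>w. map_pmf (\<lambda>v. (C w, A w, v)) (R (A w)))"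
    by (intro bind_pmf_cong) (simp_all add: cond_law_eqI[of A T M R])
  with assms show ?thesis by (simp only: cond_kernel_def)
qed

text \<open>For independent copies the kernel is the product of the single-letter kernels.\<close>

lemma cond_kernel_replicate:
  assumes "cond_kernel M C A T R"
  shows "\<exists>R'. cond_kernel (replicate_pmf n M) (map C) (map A) (map T) R'"
proof -
  define prod :: "'c list \<Rightarrow> 'd list pmf" where
    "prod as = rec_list (return_pmf []) (\<lambda>a _ p. map_pmf (\<lambda>(v, vs). v # vs) (pair_pmf (R a) p)) as" for as
  have [simp]: "prod [] = return_pmf []" "prod (a # as) = map_pmf (\<lambda>(v, vs). v # vs) (pair_pmf (R a) (prod as))" for a as
    by (simp_all add: prod_def)
  have "cond_kernel (replicate_pmf n M) (map C) (map A) (map T) prod"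
  proof (induction n)
    case 0
    then show ?case by (simp add: cond_kernel_def bind_return_pmf)
  next
    case (Suc n)
    define join :: "('b \<times> 'c \<times> 'd) \<times> 'b list \<times> 'c list \<times> 'd list \<Rightarrow> 'b list \<times> 'c list \<times> 'd list"
      where "join = (\<lambda>((c, a, v), (cs, as, vs)). (c # cs, a # as, v # vs))"
    have "map_pmf (\<lambda>w. (map C w, map A w, map T w)) (replicate_pmf (Suc n) M) =
        map_pmf join (pair_pmf (map_pmf (\<lambda>w. (C w, A w, T w)) M)
          (map_pmf (\<lambda>w. (map C w, map A w, map T w)) (replicate_pmf n M)))"
      by (simp add: join_def map_pmf_def pair_pmf_def bind_assoc_pmf bind_return_pmf)
    also have "\<dots> = bind_pmf M (\<lambda>w. bind_pmf (R (A w)) (\<lambda>v. bind_pmf (replicate_pmf n M) (\<lambda>ws.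
        bind_pmf (prod (map A ws)) (\<lambda>vs. return_pmf (C w # map C ws, A w # map A ws, v # vs)))))"
      unfolding assms[unfolded cond_kernel_def] Suc[unfolded cond_kernel_def]
      by (simp add: join_def map_pmf_def pair_pmf_def bind_assoc_pmf bind_return_pmf)
    \<comment> \<open>The draw for the first letter is independent of the remaining letters, so the
      two can be interchanged.\<close>
    also have "\<dots> = bind_pmf M (\<lambda>w. bind_pmf (replicate_pmf n M) (\<lambda>ws. bind_pmf (R (A w)) (\<lambda>v.
        bind_pmf (prod (map A ws)) (\<lambda>vs. return_pmf (C w # map C ws, A w # map A ws, v # vs)))))"
      by (subst bind_commute_pmf) (rule refl)
    finally show ?case
      by (simp add: cond_kernel_def map_pmf_def pair_pmf_def bind_assoc_pmf bind_return_pmf)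
  qed
  then show ?thesis by blast
qed

text \<open>\<open>markov_chain\<close> compares laws of \<open>W\<close>; multiplying out the two
  quotients gives a symmetric product form, which is read here as a law of \<open>T\<close>. Since
  the hypothesis covers only events of positive probability, null events are treated
  separately.\<close>

lemma markov_chain_cond_kernel:
  assumes "markov_chain M T A W"
  shows "cond_kernel M W A T (cond_law undefined M T A)"
proof -
  let ?P = "\<lambda>S. measure_pmf.prob M S"
  have "map_pmf (\<lambda>w. ((W w, A w), T w)) M =
      bind_pmf M (\<lambda>w. map_pmf (Pair (W w, A w)) (cond_law undefined M T A (A w)))"
  proof (rule pmf_eqI, clarify)
    fix c a t
    have le: "?P {w. W w = c \<and> A w = a} \<le> ?P {w. A w = a}"
      "?P {w. W w = c \<and> T w = t \<and> A w = a} \<le> ?P {w. W w = c \<and> A w = a}"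
      "?P {w. W w = c \<and> T w = t \<and> A w = a} \<le> ?P {w. T w = t \<and> A w = a}"
      by (rule measure_pmf.finite_measure_mono; auto)+
    have "?P {w. W w = c \<and> T w = t \<and> A w = a} =
        ?P {w. W w = c \<and> A w = a} * pmf (cond_law undefined M T A a) t"
    proof (cases "?P {w. A w = a} = 0")
      case True
      then have "?P {w. W w = c \<and> A w = a} = 0" using le(1) by (simp add: measure_le_0_iff)
      moreover from this have "?P {w. W w = c \<and> T w = t \<and> A w = a} = 0"
        using le(2) by (simp add: measure_le_0_iff)
      ultimately show ?thesis by simp
    next
      case False
      show ?thesis
      proof (cases "?P {w. T w = t \<and> A w = a} = 0")
        case True
        then have "?P {w. W w = c \<and> T w = t \<and> A w = a} = 0" using le(3) by (simp add: measure_le_0_iff)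
        then show ?thesis using True False by (simp add: pmf_cond_law)
      next
        case pos: False
        then have "?P {w. T w = t \<and> A w = a} > 0" by (simp add: zero_less_measure_iff)
        then have "?P {w. W w = c \<and> T w = t \<and> A w = a} / ?P {w. T w = t \<and> A w = a} =
            ?P {w. W w = c \<and> A w = a} / ?P {w. A w = a}"
          using assms by (simp add: markov_chain_def cond_prob_def)
        then show ?thesis using False pos by (simp add: pmf_cond_law field_simps)
      qed
    qed
    moreover have "pmf (map_pmf (\<lambda>w. ((W w, A w), T w)) M) ((c, a), t) =
        ?P {w. W w = c \<and> T w = t \<and> A w = a}"
      by (simp add: pmf_map vimage_def conj_commute conj_left_commute)
    moreover have "pmf (map_pmf (\<lambda>w. (W w, A w)) M) (c, a) = ?P {w. W w = c \<and> A w = a}"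
      by (simp add: pmf_map vimage_def)
    ultimately show "pmf (map_pmf (\<lambda>w. ((W w, A w), T w)) M) ((c, a), t) =
        pmf (bind_pmf M (\<lambda>w. map_pmf (Pair (W w, A w)) (cond_law undefined M T A (A w)))) ((c, a), t)"
      using pmf_bind_kernel[of M "\<lambda>w. (W w, A w)" "\<lambda>x. cond_law undefined M T A (snd x)" "(c, a)" t]
      by (simp only: snd_conv)
  qed
  from arg_cong[OF this, of "map_pmf (\<lambda>((c, a), t). (c, a, t))"]
  show ?thesis by (simp add: cond_kernel_def map_pmf_comp map_bind_pmf)
qed

section \<open>Bhattacharyya parameters close to 0 and close to 1\<close>

lemma expectation_bit_pmf:
  "measure_pmf.expectation p h = h 0 * pmf p 0 + h 1 * pmf p (1 :: bit)" for h :: "bit \<Rightarrow> real"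
proof -
  have "t \<in> {0, 1}" for t :: bit by (cases t) auto
  then show ?thesis by (subst integral_measure_pmf_real[of "{0, 1}"]) simp_all
qed

lemma pmf_bit_sum: "pmf p 0 + pmf p (1 :: bit) = 1"
  using expectation_bit_pmf[of p "\<lambda>_. 1"] by simp

text \<open>As a mean over sample points the parameter can be compared with other means by
  monotonicity and linearity. Finitely many values of \<open>A\<close> on the support turn the
  infinite sum into a finite one.\<close>

lemma bhattacharyya_eq_expectation:
  assumes "finite (A ` set_pmf M)"
  shows "bhattacharyya M T A = measure_pmf.expectation M
    (\<lambda>w. 2 * sqrt (pmf (cond_law null M T A (A w)) 0 * pmf (cond_law null M T A (A w)) 1))"
proof -
  let ?P = "\<lambda>S. measure_pmf.prob M S"
  let ?g = "\<lambda>a. sqrt (pmf (cond_law null M T A a) 0 * pmf (cond_law null M T A a) 1)"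
  have 0: "?P {w. A w = a} = 0" if "a \<notin> A ` set_pmf M" for a
    using that by (auto simp: measure_pmf_zero_iff)
  have eq: "?P {w. A w = a} * sqrt (?P {w. T w = 0 \<and> A w = a} / ?P {w. A w = a} *
      (?P {w. T w = 1 \<and> A w = a} / ?P {w. A w = a})) = ?g a * ?P {w. A w = a}" for a
    by (cases "?P {w. A w = a} = 0") (simp_all add: pmf_cond_law mult.commute)
  have "bhattacharyya M T A = 2 * (\<Sum>\<^sub>\<infinity>a\<in>UNIV. ?g a * ?P {w. A w = a})"
    by (simp only: bhattacharyya_def cond_prob_def space_measure_pmf UNIV_I simp_thms eq)
  also have "(\<Sum>\<^sub>\<infinity>a\<in>UNIV. ?g a * ?P {w. A w = a}) = (\<Sum>\<^sub>\<infinity>a\<in>A ` set_pmf M. ?g a * ?P {w. A w = a})"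
    by (rule infsum_cong_neutral) (auto simp: 0)
  also have "\<dots> = (\<Sum>a\<in>A ` set_pmf M. ?g a * pmf (map_pmf A M) a)"
    using assms by (simp add: pmf_map vimage_def)
  also have "\<dots> = measure_pmf.expectation (map_pmf A M) ?g"
    by (rule integral_measure_pmf_real[symmetric]) (use assms in auto)
  also have "2 * \<dots> = measure_pmf.expectation M (\<lambda>w. 2 * ?g (A w))"
    by simp
  finally show ?thesis .
qed

lemma integrable_bounded_pmf:
  fixes f :: "'a \<Rightarrow> real"
  assumes "\<And>x. \<bar>f x\<bar> \<le> B"
  shows "integrable (measure_pmf p) f"
  using assms by (intro measure_pmf.integrable_const_bound[where B = B]) auto

lemma le_sqrt_of_le_one: "0 \<le> x \<Longrightarrow> x \<le> 1 \<Longrightarrow> x \<le> sqrt x"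
  by (rule real_le_rsqrt) (simp add: power2_eq_square mult_left_le)

text \<open>Two independent draws from the conditional law differ with probability \<open>2 p (1 - p) \<le> 2 sqrt (p (1 - p))\<close>.\<close>

lemma close_cond_law_of_bhattacharyya_le:
  assumes "finite (A ` set_pmf M)" and "bhattacharyya M T A \<le> e"
  shows "close e (bind_pmf M (\<lambda>w. map_pmf (Pair (C w)) (cond_law null M T A (A w))))
    (map_pmf (\<lambda>w. (C w, T w)) M)"
  unfolding map_pmf_def[of "\<lambda>w. (C w, T w)"]
proof (rule close_bind_cong)
  let ?K = "\<lambda>w. cond_law null M T A (A w)"
  fix h :: "'c \<times> bit \<Rightarrow> real" and w
  assume h: "\<forall>y. 0 \<le> h y \<and> h y \<le> 1"
  have mono: "h (C w, t) * pmf (?K w) t \<le> pmf (?K w) t"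
    "h (C w, t) * pmf (?K w) t \<le> h (C w, t)" for t
    using h mult_right_mono[of "h (C w, t)" 1 "pmf (?K w) t"] mult_left_mono[of "pmf (?K w) t" 1 "h (C w, t)"]
    by (simp_all add: pmf_le_1)
  \<comment> \<open>The pointwise error is the probability that the draw misses the true bit
    \<open>T w\<close>.\<close>
  show "measure_pmf.expectation (map_pmf (Pair (C w)) (?K w)) h \<le>
      measure_pmf.expectation (return_pmf (C w, T w)) h + (1 - pmf (?K w) (T w))"
    using mono[of 0] mono[of 1] pmf_bit_sum[of "?K w"]
    by (cases "T w") (simp_all add: expectation_bit_pmf)
next
  let ?K = "\<lambda>w. cond_law null M T A (A w)"
  show "integrable (measure_pmf M) (\<lambda>w. 1 - pmf (?K w) (T w))"
    by (rule integrable_bounded_pmf[where B = 1]) (simp add: pmf_le_1)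
  let ?d = "\<lambda>(a, t). 1 - pmf (cond_law null M T A a) t"
  have "measure_pmf.expectation M (\<lambda>w. 1 - pmf (?K w) (T w)) =
      measure_pmf.expectation (map_pmf (\<lambda>w. (A w, T w)) M) ?d"
    by simp
  also have "\<dots> = measure_pmf.expectation M (\<lambda>w. 2 * (pmf (?K w) 0 * pmf (?K w) 1))"
    unfolding map_pmf_eq_bind_cond_law[of A T M null]
  proof (subst expectation_bind_pmf[where B = 1])
    show "\<bar>?d x\<bar> \<le> 1" for x by (cases x) (simp add: pmf_le_1)
    have "measure_pmf.expectation (map_pmf (Pair a) (cond_law null M T A a)) ?d =
        2 * (pmf (cond_law null M T A a) 0 * pmf (cond_law null M T A a) 1)" for a
    proof -
      let ?p = "pmf (cond_law null M T A a)"
      have "1 - ?p 0 = ?p 1" "1 - ?p 1 = ?p 0"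
        using pmf_bit_sum[of "cond_law null M T A a"] by linarith+
      then show ?thesis by (simp add: expectation_bit_pmf mult.commute)
    qed
    then show "measure_pmf.expectation M (\<lambda>w. measure_pmf.expectation (map_pmf (Pair (A w)) (?K w)) ?d) =
        measure_pmf.expectation M (\<lambda>w. 2 * (pmf (?K w) 0 * pmf (?K w) 1))"
      by (simp only:)
  qed
  also have "\<dots> \<le> measure_pmf.expectation M (\<lambda>w. 2 * sqrt (pmf (?K w) 0 * pmf (?K w) 1))"
  proof (rule integral_mono)
    have "0 \<le> pmf (?K w) 0 * pmf (?K w) 1" "pmf (?K w) 0 * pmf (?K w) 1 \<le> 1" for w
      by (simp_all add: mult_le_one pmf_le_1)
    then have sqrt: "pmf (?K w) 0 * pmf (?K w) 1 \<le> sqrt (pmf (?K w) 0 * pmf (?K w) 1)"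
        "sqrt (pmf (?K w) 0 * pmf (?K w) 1) \<le> 1" for w
      by (rule le_sqrt_of_le_one, subst real_sqrt_le_1_iff)
    show "2 * (pmf (?K w) 0 * pmf (?K w) 1) \<le> 2 * sqrt (pmf (?K w) 0 * pmf (?K w) 1)" for w
      using sqrt(1)[of w] by linarith
    show "integrable (measure_pmf M) (\<lambda>w. 2 * sqrt (pmf (?K w) 0 * pmf (?K w) 1))"
      by (rule integrable_bounded_pmf[where B = 2])
        (use mult_left_mono[OF sqrt(2), of 2] in simp)
    show "integrable (measure_pmf M) (\<lambda>w. 2 * (pmf (?K w) 0 * pmf (?K w) 1))"
      by (rule integrable_bounded_pmf[where B = 2]) (simp add: mult_le_one pmf_le_1)
  qed
  also have "\<dots> \<le> e"
    using assms by (simp add: bhattacharyya_eq_expectation[where null = null])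
  finally show "measure_pmf.expectation M (\<lambda>w. 1 - pmf (?K w) (T w)) \<le> e" .
qed

text \<open>
  With \<open>z = 2 sqrt (p (1 - p))\<close> we have \<open>|1 - 2 p| = sqrt (1 - z\<^sup>2) \<le> sqrt (2 (1 - z))\<close>. AM-GM with
  weight \<open>sqrt d\<close> bounds this by an affine function of \<open>z\<close>, which can be averaged over the
  conditioning without Jensen's inequality.
\<close>

lemma close_uniform_of_bhattacharyya_ge:
  fixes C :: "'w \<Rightarrow> 'c" and A :: "'w \<Rightarrow> 'a"
  assumes "finite (A ` set_pmf M)" and "bhattacharyya M T A \<ge> 1 - d" and "0 < d"
    and "cond_kernel M C A T R"
  shows "close (sqrt d) (bind_pmf M (\<lambda>w. map_pmf (\<lambda>b. (C w, A w, b)) (pmf_of_set {0, 1})))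
    (map_pmf (\<lambda>w. (C w, A w, T w)) M)"
proof -
  define K where "K w = cond_law undefined M T A (A w)" for w
  define z where "z w = 2 * sqrt (pmf (K w) 0 * pmf (K w) 1)" for w
  have p1: "pmf (K w) 1 = 1 - pmf (K w) 0" for w
    using pmf_bit_sum[of "K w"] by simp
  have z2: "z w ^ 2 = 1 - (1 - 2 * pmf (K w) 0) ^ 2" for w
  proof -
    have "0 \<le> pmf (K w) 0 * (1 - pmf (K w) 0)" by (simp add: pmf_le_1)
    then have "z w ^ 2 = 4 * (pmf (K w) 0 * (1 - pmf (K w) 0))"
      unfolding z_def p1 power_mult_distrib by (subst real_sqrt_pow2) auto
    then show ?thesis by (simp add: power2_eq_square algebra_simps)
  qed
  have z: "0 \<le> z w" "z w \<le> 1" for w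
  proof -
    show "0 \<le> z w" by (simp add: z_def)
    have "z w ^ 2 \<le> 1 ^ 2" by (simp add: z2)
    then show "z w \<le> 1" by (rule power2_le_imp_le) simp
  qed
  let ?d = "\<lambda>w. (sqrt d + (1 - z w) / sqrt d) / 2"
  have "close (sqrt d) (bind_pmf M (\<lambda>w. map_pmf (\<lambda>b. (C w, A w, b)) (pmf_of_set {0, 1})))
      (bind_pmf M (\<lambda>w. map_pmf (\<lambda>b. (C w, A w, b)) (K w)))"
  proof (rule close_bind_cong)
    fix h :: "'c \<times> 'a \<times> bit \<Rightarrow> real" and w
    assume h: "\<forall>y. 0 \<le> h y \<and> h y \<le> 1"
    define p where "p = pmf (K w) 0"
    have "(1 - 2 * p) ^ 2 = (1 - z w) * (1 + z w)"
      using z2[of w] by (simp add: p_def power2_eq_square algebra_simps)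
    also have "\<dots> \<le> (1 - z w) * 2"
      using z[of w] by (intro mult_left_mono) auto
    also have "\<dots> = 2 * (sqrt d * ((1 - z w) / sqrt d))"
      using \<open>0 < d\<close> by simp
    also have "\<dots> \<le> (sqrt d + (1 - z w) / sqrt d) ^ 2"
      by (simp add: power2_sum)
    finally have "\<bar>1 - 2 * p\<bar> ^ 2 \<le> (sqrt d + (1 - z w) / sqrt d) ^ 2"
      by (simp only: power2_abs)
    then have "\<bar>1 - 2 * p\<bar> \<le> sqrt d + (1 - z w) / sqrt d"
      by (rule power2_le_imp_le) (use z[of w] \<open>0 < d\<close> in simp)
    then have d: "\<bar>1 - 2 * p\<bar> / 2 \<le> ?d w" by simp
    have "0 \<le> h (C w, A w, b)" "h (C w, A w, b) \<le> 1" for b using h by auto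
    from this[of 0] this[of 1] have "\<bar>h (C w, A w, 0) - h (C w, A w, 1)\<bar> \<le> 1" by linarith
    then have "\<bar>1 - 2 * p\<bar> / 2 * \<bar>h (C w, A w, 0) - h (C w, A w, 1)\<bar> \<le> \<bar>1 - 2 * p\<bar> / 2 * 1"
      by (rule mult_left_mono) simp
    then have "\<bar>(1 - 2 * p) / 2 * (h (C w, A w, 0) - h (C w, A w, 1))\<bar> \<le> ?d w"
      using d by (simp add: abs_mult)
    then have "(1 - 2 * p) / 2 * (h (C w, A w, 0) - h (C w, A w, 1)) \<le> ?d w"
      by (rule order_trans[OF abs_ge_self])
    \<comment> \<open>The mean of \<open>h\<close> under a fair bit differs from that under
      \<open>K w\<close> by the bias \<open>(1 - 2 * p) / 2\<close> times the difference of the two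
      values of \<open>h\<close>.\<close>
    moreover have "(h (C w, A w, 0) + h (C w, A w, 1)) / 2 =
        p * h (C w, A w, 0) + (1 - p) * h (C w, A w, 1) +
        (1 - 2 * p) / 2 * (h (C w, A w, 0) - h (C w, A w, 1))"
      by (simp add: field_simps)
    ultimately have "(h (C w, A w, 0) + h (C w, A w, 1)) / 2 \<le>
        p * h (C w, A w, 0) + (1 - p) * h (C w, A w, 1) + ?d w"
      by (simp only: add_left_mono)
    then show "measure_pmf.expectation (map_pmf (\<lambda>b. (C w, A w, b)) (pmf_of_set {0, 1})) h \<le>
        measure_pmf.expectation (map_pmf (\<lambda>b. (C w, A w, b)) (K w)) h + ?d w"
      by (simp add: expectation_bit_pmf p1 p_def[symmetric] mult.commute add_divide_distrib)
  next
    have int: "integrable (measure_pmf M) z"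
      by (rule integrable_bounded_pmf[where B = 1]) (use z in \<open>simp add: abs_le_iff\<close>)
    then show "integrable (measure_pmf M) ?d" by simp
    \<comment> \<open>\<open>1 - z\<close> has mean at most \<open>d\<close>, so with weight
      \<open>sqrt d\<close> each of the two summands in \<open>?d\<close> contributes at most
      \<open>sqrt d / 2\<close>.\<close>
    have "1 - d \<le> measure_pmf.expectation M z"
      using assms(2) unfolding bhattacharyya_eq_expectation[OF assms(1), where null = undefined] z_def K_def .
    then have "(1 - measure_pmf.expectation M z) / sqrt d \<le> sqrt d"
      using \<open>0 < d\<close> by (simp add: divide_le_eq)
    then show "measure_pmf.expectation M ?d \<le> sqrt d"
      using int by simp
  qed
  \<comment> \<open>Conditional independence of \<open>T\<close> and \<open>C\<close> given
    \<open>A\<close> makes sampling from \<open>K\<close> reproduce the true joint law exactly; only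
    the bias is paid for.\<close>
  then show ?thesis
    unfolding K_def by (simp only: cond_kernel_cond_law[OF assms(4), of undefined, unfolded cond_kernel_def])
qed

section \<open>The polar transform is an involution\<close>

lemma kron_mat_carrier:
  "A \<in> carrier_mat p p' \<Longrightarrow> B \<in> carrier_mat q q' \<Longrightarrow> kron_mat A B \<in> carrier_mat (p * q) (p' * q')"
  by (auto simp: kron_mat_def)

lemma mult_mat_index:
  assumes "A \<in> carrier_mat p q" "B \<in> carrier_mat q r" "i < p" "j < r"
  shows "(A * B) $$ (i, j) = (\<Sum>k<q. A $$ (i, k) * B $$ (k, j))"
  using assms by (auto simp: scalar_prod_def atLeast0LessThan)

lemma sum_div_mod:
  fixes f g :: "nat \<Rightarrow> 'a::comm_semiring_0"
  shows "(\<Sum>k<p * q. f (k div q) * g (k mod q)) = (\<Sum>i<p. f i) * (\<Sum>j<q. g j)"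
proof -
  have "(\<Sum>k<p * q. f (k div q) * g (k mod q)) =
      (\<Sum>i<p. \<Sum>k\<in>{i * q..<i * q + q}. f (k div q) * g (k mod q))"
    by (rule sum.nat_group[symmetric])
  also have "\<dots> = (\<Sum>i<p. \<Sum>j<q. f i * g j)"
  proof (rule sum.cong[OF refl])
    fix i
    have "(\<Sum>k\<in>{i * q..<i * q + q}. f (k div q) * g (k mod q)) =
        (\<Sum>j\<in>{0..<q}. f ((j + i * q) div q) * g ((j + i * q) mod q))"
      using sum.shift_bounds_nat_ivl[of "\<lambda>k. f (k div q) * g (k mod q)" 0 "i * q" q]
      by (simp add: add.commute)
    also have "\<dots> = (\<Sum>j<q. f i * g j)"
      by (rule sum.cong) auto
    finally show "(\<Sum>k\<in>{i * q..<i * q + q}. f (k div q) * g (k mod q)) = (\<Sum>j<q. f i * g j)" .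
  qed
  finally show ?thesis by (simp add: sum_product)
qed

text \<open>The mixed product rule. Each summand splits into a factor in \<open>k div q\<close> and
  one in \<open>k mod q\<close>, so \<open>sum_div_mod\<close> applies.\<close>

lemma kron_mat_mult:
  fixes A B C D :: "'a::comm_semiring_0 mat"
  assumes carrier: "A \<in> carrier_mat p p" "C \<in> carrier_mat p p" "B \<in> carrier_mat q q" "D \<in> carrier_mat q q"
  shows "kron_mat A B * kron_mat C D = kron_mat (A * C) (B * D)"
proof (rule eq_matI)
  have [simp]: "dim_row A = p" "dim_col A = p" "dim_row C = p" "dim_col C = p"
    "dim_row B = q" "dim_col B = q" "dim_row D = q" "dim_col D = q"
    using carrier by auto
  show "dim_row (kron_mat A B * kron_mat C D) = dim_row (kron_mat (A * C) (B * D))"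
    "dim_col (kron_mat A B * kron_mat C D) = dim_col (kron_mat (A * C) (B * D))"
    by (simp_all add: kron_mat_def)
  fix i j
  assume "i < dim_row (kron_mat (A * C) (B * D))" "j < dim_col (kron_mat (A * C) (B * D))"
  then have ij: "i < p * q" "j < p * q" by (simp_all add: kron_mat_def)
  then have "0 < q" by (cases q) auto
  then have [simp]: "i div q < p" "j div q < p" "i mod q < q" "j mod q < q"
    using ij by (simp_all add: less_mult_imp_div_less)
  have "(kron_mat A B * kron_mat C D) $$ (i, j) =
      (\<Sum>k<p * q. (A $$ (i div q, k div q) * B $$ (i mod q, k mod q)) *
        (C $$ (k div q, j div q) * D $$ (k mod q, j mod q)))"
    using ij by (simp add: kron_mat_def scalar_prod_def atLeast0LessThan)
  also have "\<dots> = (\<Sum>k<p * q. (A $$ (i div q, k div q) * C $$ (k div q, j div q)) *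
        (B $$ (i mod q, k mod q) * D $$ (k mod q, j mod q)))"
    by (simp add: mult_ac)
  also have "\<dots> = (\<Sum>k<p. A $$ (i div q, k) * C $$ (k, j div q)) *
      (\<Sum>k<q. B $$ (i mod q, k) * D $$ (k, j mod q))"
    by (rule sum_div_mod)
  also have "\<dots> = kron_mat (A * C) (B * D) $$ (i, j)"
    using ij by (simp add: kron_mat_def scalar_prod_def atLeast0LessThan)
  finally show "(kron_mat A B * kron_mat C D) $$ (i, j) = kron_mat (A * C) (B * D) $$ (i, j)" .
qed

lemma kron_mat_one: "kron_mat (1\<^sub>m p) (1\<^sub>m q) = (1\<^sub>m (p * q) :: 'a::semiring_1 mat)"
proof (rule eq_matI)
  fix i j assume "i < dim_row (1\<^sub>m (p * q) :: 'a mat)" "j < dim_col (1\<^sub>m (p * q) :: 'a mat)"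
  then have ij: "i < p * q" "j < p * q" by simp_all
  then have "0 < q" by (cases q) auto
  moreover have "i = j" if "i div q = j div q" "i mod q = j mod q"
    using that by (metis div_mult_mod_eq)
  ultimately show "kron_mat (1\<^sub>m p) (1\<^sub>m q) $$ (i, j) = (1\<^sub>m (p * q) :: 'a mat) $$ (i, j)"
    using ij by (auto simp: kron_mat_def less_mult_imp_div_less)
qed (simp_all add: kron_mat_def)

section \<open>The kernel matrix, its Kronecker powers and bit reversal\<close>

definition polar_kernel :: "bit mat" where
  "polar_kernel = mat_of_rows_list 2 [[1, 0], [1, 1]]"

lemma polar_kernel_carrier: "polar_kernel \<in> carrier_mat 2 2"
  by (rule carrier_matI) (simp_all add: polar_kernel_def mat_of_rows_list_def)

lemma polar_kernel_index:
  assumes "i < 2" "j < 2"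
  shows "polar_kernel $$ (i, j) = of_bool (j \<le> i)"
  using assms by (auto simp: polar_kernel_def mat_of_rows_list_def less_2_cases_iff)

lemma polar_kernel_square: "polar_kernel * polar_kernel = 1\<^sub>m 2"
proof (rule eq_matI)
  fix i j assume "i < dim_row (1\<^sub>m 2 :: bit mat)" "j < dim_col (1\<^sub>m 2 :: bit mat)"
  then have ij: "i < 2" "j < 2" by simp_all
  have "(\<Sum>k<2. polar_kernel $$ (i, k) * polar_kernel $$ (k, j)) = of_bool (i = j)"
    using ij by (auto simp: polar_kernel_index numeral_2_eq_2 lessThan_Suc less_Suc_eq)
  then show "(polar_kernel * polar_kernel) $$ (i, j) = 1\<^sub>m 2 $$ (i, j)"
    using ij by (simp add: mult_mat_index[OF polar_kernel_carrier polar_kernel_carrier])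
qed (use polar_kernel_carrier in auto)

lemma kron_power_polar_kernel_carrier: "kron_power polar_kernel n \<in> carrier_mat (2 ^ n) (2 ^ n)"
  by (induction n) (simp_all add: kron_mat_carrier polar_kernel_carrier)

lemma kron_power_polar_kernel_square:
  "kron_power polar_kernel n * kron_power polar_kernel n = 1\<^sub>m (2 ^ n)"
  by (induction n)
    (simp_all add: kron_mat_mult[OF polar_kernel_carrier polar_kernel_carrier
      kron_power_polar_kernel_carrier kron_power_polar_kernel_carrier] polar_kernel_square kron_mat_one)

text \<open>Each Kronecker factor compares one binary digit of the two indices, and
  \<open>polar_kernel\<close> is lower triangular. In this form the effect of reversing digits can
  be read off.\<close>

lemma kron_power_polar_kernel_index:
  assumes "i < 2 ^ n" "j < 2 ^ n"
  shows "kron_power polar_kernel n $$ (i, j) = of_bool (\<forall>k<n. bit j k \<longrightarrow> bit i k)"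
  using assms
proof (induction n arbitrary: i j)
  case (Suc n)
  have dim: "dim_row (kron_power polar_kernel n) = 2 ^ n" "dim_col (kron_power polar_kernel n) = 2 ^ n"
    using kron_power_polar_kernel_carrier[of n] by auto
  have div: "a div 2 ^ n < 2" "a div 2 ^ n = of_bool (bit a n)" if "a < 2 ^ Suc n" for a :: nat
  proof -
    show "a div 2 ^ n < 2" using that by (simp add: less_mult_imp_div_less)
    then show "a div 2 ^ n = of_bool (bit a n)" by (auto simp: bit_iff_odd less_2_cases_iff)
  qed
  have bit: "bit (a mod 2 ^ n) k \<longleftrightarrow> k < n \<and> bit a k" for a k :: nat
    by (simp add: bit_take_bit_iff flip: take_bit_eq_mod)
  have "kron_power polar_kernel (Suc n) $$ (i, j) =
      polar_kernel $$ (i div 2 ^ n, j div 2 ^ n) * kron_power polar_kernel n $$ (i mod 2 ^ n, j mod 2 ^ n)"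
    using Suc.prems polar_kernel_carrier by (auto simp: kron_mat_def dim)
  also have "\<dots> = of_bool (bit j n \<longrightarrow> bit i n) * of_bool (\<forall>k<n. bit j k \<longrightarrow> bit i k)"
    using div[OF Suc.prems(1)] div[OF Suc.prems(2)]
    by (simp add: polar_kernel_index Suc.IH bit cong: conj_cong imp_cong)
  finally show ?case by (auto simp: less_Suc_eq)
qed simp

text \<open>Reordering by the target position \<open>n - 1 - k\<close> gives a Horner sum of bits,
  from which the digits and the bound \<open>2 ^ n\<close> follow.\<close>

lemma bit_reversal_eq_horner_sum:
  "bit_reversal n i = horner_sum of_bool 2 (map (\<lambda>k. bit i (n - 1 - k)) [0..<n])"
proof -
  have "bit_reversal n i = (\<Sum>k<n. (i div 2 ^ (n - Suc k) mod 2) * 2 ^ (n - 1 - (n - Suc k)))"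
    unfolding bit_reversal_def by (rule sum.nat_diff_reindex[symmetric])
  also have "\<dots> = (\<Sum>k<n. of_bool (bit i (n - 1 - k)) * 2 ^ k)"
    by (rule sum.cong) (auto simp: bit_iff_odd mod_2_eq_odd)
  finally show ?thesis
    by (simp only: horner_sum_eq_sum length_map length_upt diff_zero) (simp add: atLeast0LessThan)
qed

lemma bit_bit_reversal: "bit (bit_reversal n i) k \<longleftrightarrow> k < n \<and> bit i (n - 1 - k)"
  by (auto simp: bit_reversal_eq_horner_sum bit_horner_sum_bit_iff)

lemma bit_reversal_less: "bit_reversal n i < 2 ^ n"
  using horner_sum_of_bool_2_less[of "map (\<lambda>k. bit i (n - 1 - k)) [0..<n]"]
  by (simp add: bit_reversal_eq_horner_sum)

lemma bit_reversal_bit_reversal: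
  assumes "i < 2 ^ n"
  shows "bit_reversal n (bit_reversal n i) = i"
proof (rule bit_eqI)
  fix k
  have "bit i k \<Longrightarrow> k < n"
    using assms by (metis bit_take_bit_iff take_bit_nat_eq_self)
  then show "bit (bit_reversal n (bit_reversal n i)) k \<longleftrightarrow> bit i k"
    by (auto simp: bit_bit_reversal)
qed

lemma polar_mat_carrier: "polar_mat n \<in> carrier_mat (2 ^ n) (2 ^ n)"
  using kron_power_polar_kernel_carrier[of n]
  unfolding polar_mat_def polar_kernel_def[symmetric] by (rule mult_carrier_mat[rotated]) simp

text \<open>The bit reversal matrix \<open>B\<close> and the Kronecker power \<open>F\<close> are
  commuting involutions, so the square of \<open>B * F\<close> is \<open>B * (F * F) * B\<close>,
  the identity.\<close>

lemma polar_mat_square: "polar_mat n * polar_mat n = 1\<^sub>m (2 ^ n)"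
proof -
  define B where "B = mat (2 ^ n) (2 ^ n) (\<lambda>(i, j). if j = bit_reversal n i then 1 else 0 :: bit)"
  define F where "F = kron_power polar_kernel n"
  have B: "B \<in> carrier_mat (2 ^ n) (2 ^ n)" by (simp add: B_def)
  have F: "F \<in> carrier_mat (2 ^ n) (2 ^ n)" by (simp add: F_def kron_power_polar_kernel_carrier)
  have BF: "(B * F) $$ (i, j) = F $$ (bit_reversal n i, j)" if "i < 2 ^ n" "j < 2 ^ n" for i j
  proof -
    have "(B * F) $$ (i, j) = (\<Sum>k<2 ^ n. if bit_reversal n i = k then F $$ (k, j) else 0)"
      unfolding mult_mat_index[OF B F that]
      by (rule sum.cong[OF refl]) (use that in \<open>simp only: B_def index_mat lessThan_iff, simp\<close>)
    then show ?thesis by (simp only: sum.delta' finite_lessThan lessThan_iff bit_reversal_less if_True)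
  qed
  have FB: "(F * B) $$ (i, j) = F $$ (i, bit_reversal n j)" if "i < 2 ^ n" "j < 2 ^ n" for i j
  proof -
    have j: "j = bit_reversal n k \<longleftrightarrow> bit_reversal n j = k" if "k < 2 ^ n" for k
      using bit_reversal_bit_reversal[OF that] bit_reversal_bit_reversal[OF \<open>j < 2 ^ n\<close>] by metis
    have "(F * B) $$ (i, j) = (\<Sum>k<2 ^ n. if bit_reversal n j = k then F $$ (i, k) else 0)"
      unfolding mult_mat_index[OF F B that]
      by (rule sum.cong[OF refl]) (use that j in \<open>simp only: B_def index_mat lessThan_iff, simp\<close>)
    then show ?thesis by (simp only: sum.delta' finite_lessThan lessThan_iff bit_reversal_less if_True)
  qed
  have BB: "B * B = 1\<^sub>m (2 ^ n)"
  proof (rule eq_matI)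
    fix i j assume "i < dim_row (1\<^sub>m (2 ^ n) :: bit mat)" "j < dim_col (1\<^sub>m (2 ^ n) :: bit mat)"
    then have ij: "i < 2 ^ n" "j < 2 ^ n" by simp_all
    have "(B * B) $$ (i, j) = (\<Sum>k<2 ^ n. if bit_reversal n i = k then B $$ (k, j) else 0)"
      unfolding mult_mat_index[OF B B ij]
      by (rule sum.cong[OF refl]) (use ij in \<open>simp only: B_def index_mat lessThan_iff, simp\<close>)
    also have "\<dots> = B $$ (bit_reversal n i, j)"
      by (simp only: sum.delta' finite_lessThan lessThan_iff bit_reversal_less if_True)
    finally show "(B * B) $$ (i, j) = 1\<^sub>m (2 ^ n) $$ (i, j)"
      using ij by (simp add: B_def bit_reversal_less bit_reversal_bit_reversal)
  qed (use B in auto)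
  \<comment> \<open>Inclusion between the digit sets of two indices is unchanged when both indices
    are reversed, which is what moving \<open>B\<close> across \<open>F\<close> amounts to.\<close>
  have comm: "B * F = F * B"
  proof (rule eq_matI)
    fix i j assume "i < dim_row (F * B)" "j < dim_col (F * B)"
    then have ij: "i < 2 ^ n" "j < 2 ^ n" using B F by auto
    have "(\<forall>k<n. bit j k \<longrightarrow> bit (bit_reversal n i) k) \<longleftrightarrow> (\<forall>k<n. bit (bit_reversal n j) k \<longrightarrow> bit i k)"
      (is "?l \<longleftrightarrow> ?r")
    proof
      assume ?l
      show ?r
      proof (intro allI impI)
        fix k assume "k < n" "bit (bit_reversal n j) k"
        then have "bit j (n - 1 - k)" "n - 1 - k < n" by (auto simp: bit_bit_reversal)
        with \<open>?l\<close> have "bit (bit_reversal n i) (n - 1 - k)" by blast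
        with \<open>k < n\<close> show "bit i k" by (simp add: bit_bit_reversal)
      qed
    next
      assume ?r
      show ?l
      proof (intro allI impI)
        fix k assume "k < n" "bit j k"
        then have "bit (bit_reversal n j) (n - 1 - k)" "n - 1 - k < n" by (auto simp: bit_bit_reversal)
        with \<open>?r\<close> have "bit i (n - 1 - k)" by blast
        with \<open>k < n\<close> show "bit (bit_reversal n i) k" by (simp add: bit_bit_reversal)
      qed
    qed
    then show "(B * F) $$ (i, j) = (F * B) $$ (i, j)"
      using ij by (simp add: BF FB) (simp add: F_def kron_power_polar_kernel_index bit_reversal_less)
  qed (use B F in auto)
  have "(B * F) * (B * F) = (B * F) * (F * B)" by (simp only: comm)
  also have "\<dots> = B * ((F * F) * B)"
    using B F by (simp add: assoc_mult_mat[of _ "2 ^ n" "2 ^ n" _ "2 ^ n" _ "2 ^ n"])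
  also have "\<dots> = 1\<^sub>m (2 ^ n)"
    using B by (simp add: F_def kron_power_polar_kernel_square BB)
  finally show ?thesis by (simp only: polar_mat_def B_def F_def polar_kernel_def)
qed

lemma length_polar_transform [simp]: "length (polar_transform n u) = 2 ^ n"
  by (simp add: polar_transform_def)

lemma polar_transform_polar_transform:
  assumes "length u = 2 ^ n"
  shows "polar_transform n (polar_transform n u) = u"
proof -
  \<comment> \<open>\<open>polar_transform\<close> multiplies a row vector by the matrix; the
    transpose turns this into an action on column vectors.\<close>
  let ?G = "transpose_mat (polar_mat n)"
  have G: "?G \<in> carrier_mat (2 ^ n) (2 ^ n)" using polar_mat_carrier by simp
  have eq: "vec_of_list (polar_transform n u) = ?G *\<^sub>v vec_of_list u" if "length u = 2 ^ n" for u
  proof (rule eq_vecI)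
    fix j assume "j < dim_vec (?G *\<^sub>v vec_of_list u)"
    then have "j < 2 ^ n" using G by simp
    then show "vec_of_list (polar_transform n u) $ j = (?G *\<^sub>v vec_of_list u) $ j"
      using G polar_mat_carrier[of n] that
      by (simp add: vec_of_list_index polar_transform_def comm_scalar_prod[of _ "2 ^ n"] carrier_vecI)
  qed (use G in simp)
  have u: "vec_of_list u \<in> carrier_vec (2 ^ n)" using assms by (simp add: carrier_vecI)
  have "vec_of_list (polar_transform n (polar_transform n u)) = ?G *\<^sub>v (?G *\<^sub>v vec_of_list u)"
    using assms by (simp add: eq)
  also have "\<dots> = transpose_mat (polar_mat n * polar_mat n) *\<^sub>v vec_of_list u"
    using polar_mat_carrier[of n] u
    by (simp add: transpose_mult[of _ "2 ^ n" "2 ^ n" _ "2 ^ n"] assoc_mult_mat_vec[of _ "2 ^ n" "2 ^ n" _ "2 ^ n"])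
  also have "\<dots> = vec_of_list u" using u by (simp add: polar_mat_square)
  finally show ?thesis by (metis list_vec)
qed

section \<open>One round of the protocol\<close>

text \<open>Only the partition of the sample space into fibers of the conditioning variable
  matters.\<close>

lemma bhattacharyya_reindex:
  assumes fin: "finite (A ` set_pmf M)" "finite (B ` set_pmf M)"
    and eq: "\<And>w w'. A w' = A w \<longleftrightarrow> B w' = B w"
  shows "bhattacharyya M T A = bhattacharyya M T B"
proof -
  have "cond_law (\<lambda>_. return_pmf 0) M T A (A w) = cond_law (\<lambda>_. return_pmf 0) M T B (B w)" for w
    by (simp add: cond_law_def eq)
  then show ?thesis
    unfolding bhattacharyya_eq_expectation[OF fin(1), where null = "\<lambda>_. return_pmf 0"]
      bhattacharyya_eq_expectation[OF fin(2), where null = "\<lambda>_. return_pmf 0"]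
    by simp
qed

lemma finite_bit_lists: "finite {v :: bit list. length v \<le> k}"
proof -
  have "{v :: bit list. length v \<le> k} = {v. set v \<subseteq> {0, 1} \<and> length v \<le> k}"
    by (auto intro: bit.exhaust)
  then show ?thesis by (simp add: finite_lists_length_le)
qed

lemma delta_bounds: "0 < delta \<beta> n" "delta \<beta> n \<le> 1"
  by (simp_all add: delta_def powr_minus_divide ge_one_powr_ge_zero)

lemma delta_le_sqrt: "delta \<beta> n \<le> sqrt (delta \<beta> n)"
  using delta_bounds[of \<beta> n] by (intro le_sqrt_of_le_one) auto

context interaction
begin

lemma length_ideal: "ws \<in> set_pmf (ideal n) \<Longrightarrow> length ws = 2 ^ n"
  by (auto simp: ideal_def set_replicate_pmf)

lemma length_V [simp]: "length (V n l ws) = 2 ^ n"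
  by (simp add: V_def)

lemma U_blocks_Suc: "U_blocks (Suc l) ws = U_blocks l ws @ [map (U (Suc l)) ws]"
  by (simp add: U_blocks_def)

lemma polar_transform_V:
  "ws \<in> set_pmf (ideal n) \<Longrightarrow> polar_transform n (V n l ws) = map (U l) ws"
  by (simp add: V_def polar_transform_polar_transform length_ideal)

text \<open>
  Conditioning on \<open>map (side_info s l) ws\<close> (used for the index sets) and conditioning on
  \<open>(map (obs s) ws, U_blocks (l - 1) ws)\<close> (used for the sampling laws) amount to the same.
\<close>

definition blocks_of_info :: "nat \<Rightarrow> (('x + 'y) \<times> bit list) list \<Rightarrow> bit list list" where
  "blocks_of_info l is = map (\<lambda>i. map (\<lambda>p. snd p ! (i - 1)) is) [1..<Suc (l - 1)]"

definition info_of_blocks :: "('x + 'y) list \<Rightarrow> bit list list \<Rightarrow> (('x + 'y) \<times> bit list) list" where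
  "info_of_blocks os bs = map (\<lambda>k. (os ! k, map (\<lambda>b. b ! k) bs)) [0..<length os]"

lemma blocks_of_info: "blocks_of_info l (map (side_info s l) ws) = U_blocks (l - 1) ws"
proof -
  have "snd (side_info s l \<omega>) ! (i - 1) = U i \<omega>" if "1 \<le> i" "i < Suc (l - 1)" for i \<omega>
    using that nth_upt[of 1 "i - 1" "Suc (l - 1)"] by (simp add: side_info_def Us_def del: upt_Suc)
  then show ?thesis
    by (auto simp: blocks_of_info_def U_blocks_def simp del: upt_Suc)
qed

lemma info_of_blocks:
  "info_of_blocks (map (obs s) ws) (U_blocks (l - 1) ws) = map (side_info s l) ws"
  by (rule nth_equalityI) (auto simp: info_of_blocks_def U_blocks_def side_info_def Us_def)

lemma map_fst_side_info: "map fst (map (side_info s l) ws) = map (obs s) ws"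
  by (simp add: side_info_def)

lemma info_eq_iff:
  "(take j (V n l ws'), map (side_info s l) ws') = (take j (V n l ws), map (side_info s l) ws) \<longleftrightarrow>
   (take j (V n l ws'), map (obs s) ws', U_blocks (l - 1) ws') =
   (take j (V n l ws), map (obs s) ws, U_blocks (l - 1) ws)"
  by (metis (no_types, lifting) Pair_inject blocks_of_info info_of_blocks map_fst_side_info)

lemma finite_prefixes: "finite ((\<lambda>ws. take j (V n l ws)) ` S)"
  by (rule finite_subset[OF _ finite_bit_lists[of "2 ^ n"]]) auto

lemma finite_info:
  assumes "finite (range X)" "finite (range Y)"
  shows "finite ((\<lambda>ws. (take j (V n l ws), map (side_info s l) ws)) ` set_pmf (ideal n))"
proof -
  define I where "I = (Inl ` range X \<union> Inr ` range Y) \<times> {v :: bit list. length v \<le> l}"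
  have "side_info s l w \<in> I" for w
    by (cases s) (auto simp: I_def side_info_def obs_def Us_def)
  then have "(\<lambda>ws. (take j (V n l ws), map (side_info s l) ws)) ` set_pmf (ideal n) \<subseteq>
      {v. length v \<le> 2 ^ n} \<times> {is. set is \<subseteq> I \<and> length is = 2 ^ n}"
    by (auto simp: length_ideal)
  moreover have "finite I" unfolding I_def using assms finite_bit_lists by (intro finite_SigmaI) auto
  ultimately show ?thesis
    by (rule finite_subset[OF _ finite_cartesian_product[OF finite_bit_lists finite_lists_length_eq]])
qed

lemma finite_blocks:
  assumes "finite (range X)" "finite (range Y)"
  shows "finite ((\<lambda>ws. (take j (V n l ws), map (obs s) ws, U_blocks (l - 1) ws)) ` set_pmf (ideal n))"
proof -
  have "(\<lambda>ws. (take j (V n l ws), map (obs s) ws, U_blocks (l - 1) ws)) =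
      (\<lambda>(v, is). (v, map fst is, blocks_of_info l is)) \<circ>
        (\<lambda>ws. (take j (V n l ws), map (side_info s l) ws))"
    by (simp add: fun_eq_iff blocks_of_info map_fst_side_info del: map_map)
  then show ?thesis
    by (simp only: image_comp[symmetric]) (rule finite_imageI[OF finite_info[OF assms]])
qed

text \<open>The context for replacing bits in round \<open>l + 1\<close>: with both observations in
  it, closeness speaks about both terminals at once.\<close>

definition view :: "nat \<Rightarrow> 'w list \<Rightarrow> 'x list \<times> 'y list \<times> bit list list" where
  "view l ws = (map X ws, map Y ws, U_blocks l ws)"

text \<open>The single-letter independence is lifted to blocks and pushed through the polar
  transform; then \<open>cond_kernel_chain\<close> moves the prefix into the condition.\<close>

lemma ideal_cond_kernel:
  assumes "cond_kernel M (\<lambda>\<omega>. (X \<omega>, Y \<omega>)) (side_info s l) (U l) R"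
  shows "\<exists>R'. cond_kernel (ideal n) (view (l - 1))
    (\<lambda>ws. (take j (V n l ws), map (side_info s l) ws)) (\<lambda>ws. V n l ws ! j) R'"
proof -
  obtain R' where "cond_kernel (ideal n) (map (\<lambda>\<omega>. (X \<omega>, Y \<omega>))) (map (side_info s l)) (map (U l)) R'"
    using cond_kernel_replicate[OF assms, of "2 ^ n"] unfolding ideal_def by blast
  from cond_kernel_map[OF this, of "\<lambda>u. (take j (polar_transform n u), polar_transform n u ! j)"]
  have "\<exists>R'. cond_kernel (ideal n) (map (\<lambda>\<omega>. (X \<omega>, Y \<omega>))) (map (side_info s l))
      (\<lambda>ws. (take j (V n l ws), V n l ws ! j)) R'"
    unfolding V_def by blast
  then obtain R'' where "cond_kernel (ideal n) (map (\<lambda>\<omega>. (X \<omega>, Y \<omega>))) (map (side_info s l))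
      (\<lambda>ws. (take j (V n l ws), V n l ws ! j)) R''"
    by blast
  \<comment> \<open>The blocks of earlier rounds in \<open>view\<close> are functions of the side
    information, so they can join the context.\<close>
  from cond_kernel_context[OF cond_kernel_chain[OF this], of "view (l - 1)" "\<lambda>xy p. (map fst xy, map snd xy, blocks_of_info l (snd p))"]
  show ?thesis by (auto simp: view_def blocks_of_info comp_def simp del: map_map) (auto simp: comp_def)
qed

text \<open>The context is arbitrary: an almost determined bit is reproduced together with
  everything correlated with it.\<close>

lemma close_law_d:
  assumes "j \<in> F_d n l"
  shows "close (delta \<beta> n)
    (bind_pmf (ideal n) (\<lambda>ws. map_pmf (\<lambda>b. (C ws, take j (V n l ws), b)) (law_d n l j (take j (V n l ws)))))
    (map_pmf (\<lambda>ws. (C ws, take j (V n l ws), V n l ws ! j)) (ideal n))"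
proof -
  have "close (delta \<beta> n)
      (bind_pmf (ideal n) (\<lambda>ws. map_pmf (Pair (C ws, take j (V n l ws))) (law_d n l j (take j (V n l ws)))))
      (map_pmf (\<lambda>ws. ((C ws, take j (V n l ws)), V n l ws ! j)) (ideal n))"
    unfolding law_d_def
    by (rule close_cond_law_of_bhattacharyya_le[OF finite_prefixes])
      (use assms in \<open>simp add: F_d_def low_def\<close>)
  from close_map[OF this, of "\<lambda>((c, v), b). (c, v, b)"] show ?thesis
    by (simp add: map_pmf_comp map_bind_pmf)
qed

lemma close_law_i_low:
  assumes "finite (range X)" "finite (range Y)" and "j \<in> low_given n l (side_info s l)"
  shows "close (delta \<beta> n)
    (bind_pmf (ideal n) (\<lambda>ws. map_pmf (\<lambda>b. (C ws, take j (V n l ws), b))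
      (law_i n l s j (take j (V n l ws), map (obs s) ws, U_blocks (l - 1) ws))))
    (map_pmf (\<lambda>ws. (C ws, take j (V n l ws), V n l ws ! j)) (ideal n))"
proof -
  have "bhattacharyya (ideal n) (\<lambda>ws. V n l ws ! j)
      (\<lambda>ws. (take j (V n l ws), map (obs s) ws, U_blocks (l - 1) ws)) \<le> delta \<beta> n"
    using assms(3) bhattacharyya_reindex[OF finite_info[OF assms(1,2)] finite_blocks[OF assms(1,2)] info_eq_iff]
    by (simp add: low_given_def)
  from close_cond_law_of_bhattacharyya_le[OF finite_blocks[OF assms(1,2)] this,
      of "\<lambda>ws. (C ws, take j (V n l ws))" "null_i n l j"]
  have "close (delta \<beta> n)
      (bind_pmf (ideal n) (\<lambda>ws. map_pmf (Pair (C ws, take j (V n l ws)))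
        (law_i n l s j (take j (V n l ws), map (obs s) ws, U_blocks (l - 1) ws))))
      (map_pmf (\<lambda>ws. ((C ws, take j (V n l ws)), V n l ws ! j)) (ideal n))"
    by (simp only: law_i_def)
  from close_map[OF this, of "\<lambda>((c, v), b). (c, v, b)"] show ?thesis
    by (simp add: map_pmf_comp map_bind_pmf)
qed

text \<open>Sampling is exact: given the prefix and what terminal \<open>s\<close> knows, the bit is
  independent of the other observation, so \<open>law_i\<close> is also its law given all of
  \<open>view\<close>.\<close>

lemma bind_law_i:
  assumes "cond_kernel M (\<lambda>\<omega>. (X \<omega>, Y \<omega>)) (side_info s l) (U l) R"
  shows "bind_pmf (ideal n) (\<lambda>ws. map_pmf (\<lambda>b. (view (l - 1) ws, take j (V n l ws), b))
      (law_i n l s j (take j (V n l ws), map (obs s) ws, U_blocks (l - 1) ws))) =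
    map_pmf (\<lambda>ws. (view (l - 1) ws, take j (V n l ws), V n l ws ! j)) (ideal n)"
proof -
  let ?B = "\<lambda>ws. (take j (V n l ws), map (obs s) ws, U_blocks (l - 1) ws)"
  obtain R' where R': "cond_kernel (ideal n) (view (l - 1))
      (\<lambda>ws. (take j (V n l ws), map (side_info s l) ws)) (\<lambda>ws. V n l ws ! j) R'"
    using ideal_cond_kernel[OF assms] by blast
  have "cond_kernel (ideal n) (view (l - 1)) ?B (\<lambda>ws. V n l ws ! j)
      (\<lambda>b. R' ((\<lambda>(v, os, bs). (v, info_of_blocks os bs)) b))"
    by (rule cond_kernel_reindex[OF R', where f = "\<lambda>(v, is). (v, map fst is, blocks_of_info l is)"])
      (simp_all add: blocks_of_info map_fst_side_info info_of_blocks del: map_map One_nat_def)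
  from cond_kernel_cond_law[OF this, of "null_i n l j"]
  have "map_pmf (\<lambda>ws. (view (l - 1) ws, ?B ws, V n l ws ! j)) (ideal n) =
      bind_pmf (ideal n) (\<lambda>ws. map_pmf (\<lambda>b. (view (l - 1) ws, ?B ws, b)) (law_i n l s j (?B ws)))"
    by (simp only: cond_kernel_def law_i_def)
  from arg_cong[OF this, of "map_pmf (\<lambda>(c, b, t). (c, fst b, t))"] show ?thesis
    by (simp add: map_pmf_comp map_bind_pmf)
qed

text \<open>The parameter is near 1 given the side information of \<open>s\<close>; conditional
  independence extends the near-uniformity to all of \<open>view\<close>.\<close>

lemma close_uniform:
  assumes "finite (range X)" "finite (range Y)"
    and "cond_kernel M (\<lambda>\<omega>. (X \<omega>, Y \<omega>)) (side_info s l) (U l) R"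
    and "j \<in> high_given n l (side_info s l)"
  shows "close (sqrt (delta \<beta> n))
    (bind_pmf (ideal n) (\<lambda>ws. map_pmf (\<lambda>b. (view (l - 1) ws, take j (V n l ws), b)) (pmf_of_set {0, 1})))
    (map_pmf (\<lambda>ws. (view (l - 1) ws, take j (V n l ws), V n l ws ! j)) (ideal n))"
proof -
  let ?A = "\<lambda>ws. (take j (V n l ws), map (side_info s l) ws)"
  obtain R' where "cond_kernel (ideal n) (view (l - 1)) ?A (\<lambda>ws. V n l ws ! j) R'"
    using ideal_cond_kernel[OF assms(3)] by blast
  then have "close (sqrt (delta \<beta> n))
      (bind_pmf (ideal n) (\<lambda>ws. map_pmf (\<lambda>b. (view (l - 1) ws, ?A ws, b)) (pmf_of_set {0, 1})))
      (map_pmf (\<lambda>ws. (view (l - 1) ws, ?A ws, V n l ws ! j)) (ideal n))"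
    using assms(4)
    by (intro close_uniform_of_bhattacharyya_ge[OF finite_info[OF assms(1,2)]])
      (simp_all add: high_given_def delta_bounds)
  from close_map[OF this, of "\<lambda>(c, a, b). (c, fst a, b)"] show ?thesis
    by (simp add: map_pmf_comp map_bind_pmf)
qed

lemma close_transmitter_bit:
  assumes "finite (range X)" "finite (range Y)"
    and "cond_kernel M (\<lambda>\<omega>. (X \<omega>, Y \<omega>)) (side_info (transmitter l) l) (U l) R"
  shows "close (sqrt (delta \<beta> n))
    (bind_pmf (ideal n) (\<lambda>ws. map_pmf (\<lambda>b. (view (l - 1) ws, take j (V n l ws), b))
      (transmitter_bit n l (map (obs (transmitter l)) ws) (U_blocks (l - 1) ws) j (take j (V n l ws)))))
    (map_pmf (\<lambda>ws. (view (l - 1) ws, take j (V n l ws), V n l ws ! j)) (ideal n))"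
proof -
  consider "j \<in> F_r n l" | "j \<notin> F_r n l" "j \<in> F_d n l" | "j \<notin> F_r n l" "j \<notin> F_d n l" by blast
  then show ?thesis
  proof cases
    case 1
    then have "j \<in> high_given n l (side_info (transmitter l) l)" by (simp add: F_r_def)
    from close_uniform[OF assms this] 1 show ?thesis by (simp only: transmitter_bit_def if_True)
  next
    case 2
    from close_mono[OF close_law_d[OF 2(2)] delta_le_sqrt] 2 show ?thesis
      by (simp only: transmitter_bit_def if_True if_False)
  next
    case 3
    then show ?thesis
      using delta_bounds(1)[of \<beta> n] bind_law_i[OF assms(3)]
      by (simp only: transmitter_bit_def if_False) (rule close_mono[OF close_refl], simp)
  qed
qed

text \<open>The list of the transmitter is taken to be the ideal \<open>V n l ws\<close>, so the
  bits copied from it are exact.\<close>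

lemma close_receiver_bit:
  assumes "finite (range X)" "finite (range Y)" and "j < 2 ^ n"
  shows "close (sqrt (delta \<beta> n))
    (bind_pmf (ideal n) (\<lambda>ws. map_pmf (\<lambda>b. (C ws, take j (V n l ws), b))
      (receiver_bit n l (map (obs (receiver l)) ws) (U_blocks (l - 1) ws) (V n l ws) j (take j (V n l ws)))))
    (map_pmf (\<lambda>ws. (C ws, take j (V n l ws), V n l ws ! j)) (ideal n))"
proof -
  consider "j \<in> F_r n l \<union> I_sent n l" | "j \<notin> F_r n l \<union> I_sent n l" "j \<in> F_d n l"
    | "j \<notin> F_r n l \<union> I_sent n l" "j \<notin> F_d n l" by blast
  then show ?thesis
  proof cases
    case 1
    then show ?thesis using delta_bounds(1)[of \<beta> n]
      by (simp only: receiver_bit_def if_True map_return_pmf)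
        (simp only: map_pmf_def, rule close_mono[OF close_refl], simp)
  next
    case 2
    from close_mono[OF close_law_d[OF 2(2)] delta_le_sqrt] 2 show ?thesis
      by (simp only: receiver_bit_def if_True if_False)
  next
    case 3
    \<comment> \<open>Outside \<open>F_r\<close> and \<open>F_d\<close> the position lies in
      \<open>I_set\<close>; it is missing from \<open>I_sent\<close> because the receiver's side
      information almost determines the bit.\<close>
    then have "j \<in> low_given n l (side_info (receiver l) l)"
      using assms(3) by (auto simp: F_r_def F_d_def I_sent_def I_set_def)
    from close_mono[OF close_law_i_low[OF assms(1,2) this] delta_le_sqrt] 3 show ?thesis
      by (simp only: receiver_bit_def if_False)
  qed
qed

end

section \<open>Distance to the ideal distribution\<close>

context interaction
begin

definition obs_block :: "'x list \<Rightarrow> 'y list \<Rightarrow> terminal \<Rightarrow> ('x + 'y) list" where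
  "obs_block xs ys s = (case s of TA \<Rightarrow> map Inl xs | TB \<Rightarrow> map Inr ys)"

lemma obs_block: "obs_block (map X ws) (map Y ws) s = map (obs s) ws"
  by (cases s) (simp_all add: obs_block_def obs_def)

text \<open>A round as a kernel on the global state. Observations are rebuilt from \<open>xs\<close>
  and \<open>ys\<close> instead of the sample point, so that errors of earlier rounds propagate by
  \<open>close_bind\<close>.\<close>

definition advance ::
  "nat \<Rightarrow> nat \<Rightarrow> 'x list \<times> 'y list \<times> (terminal \<Rightarrow> bit list list)
     \<Rightarrow> ('x list \<times> 'y list \<times> (terminal \<Rightarrow> bit list list)) pmf" where
  "advance n l = (\<lambda>(xs, ys, us).
     map_pmf (\<lambda>us'. (xs, ys, us')) (round_step n (obs_block xs ys) l us))"

definition ideal_state :: "nat \<Rightarrow> nat \<Rightarrow> ('x list \<times> 'y list \<times> (terminal \<Rightarrow> bit list list)) pmf" where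
  "ideal_state n l = map_pmf (\<lambda>ws. (map X ws, map Y ws, \<lambda>_. U_blocks l ws)) (ideal n)"

text \<open>First the list drawn by the transmitter is replaced by the ideal one, then the receiver
  is run on the ideal list. Each replacement accounts for one of the two copies of
  \<open>2 ^ n * sqrt (delta \<beta> n)\<close>.\<close>

lemma close_round:
  assumes "finite (range X)" "finite (range Y)"
    and "cond_kernel M (\<lambda>\<omega>. (X \<omega>, Y \<omega>)) (side_info (transmitter (Suc l)) (Suc l)) (U (Suc l)) R"
  shows "close (2 * (2 ^ n * sqrt (delta \<beta> n)))
    (bind_pmf (ideal_state n l) (advance n (Suc l))) (ideal_state n (Suc l))"
proof -
  let ?l = "Suc l"
  let ?S = "transmitter ?l" and ?R = "receiver ?l"
  let ?N = "2 ^ n :: nat" and ?e = "sqrt (delta \<beta> n)"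
  define fT where "fT = (\<lambda>(xs, ys, u). transmitter_bit n ?l (obs_block xs ys ?S) u)"
  define fR where "fR = (\<lambda>((xs, ys, u), v). receiver_bit n ?l (obs_block xs ys ?R) u v)"
  \<comment> \<open>The whole receiver draw is one kernel, so the error made by the transmitter does
    not grow in it.\<close>
  define k where "k = (\<lambda>cv. map_pmf (Pair cv) (successive (fR cv) ?N))"
  define out :: "(('x list \<times> 'y list \<times> bit list list) \<times> bit list) \<times> bit list \<Rightarrow>
      'x list \<times> 'y list \<times> (terminal \<Rightarrow> bit list list)"
    where "out = (\<lambda>(((xs, ys, u), vS), vR).
      (xs, ys, (\<lambda>_. u)(?S := u @ [polar_transform n vS], ?R := u @ [polar_transform n vR])))"
  have "close (real ?N * ?e)
      (bind_pmf (ideal n) (\<lambda>ws. map_pmf (Pair (view l ws)) (successive (fT (view l ws)) ?N)))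
      (map_pmf (\<lambda>ws. (view l ws, take ?N (V n ?l ws))) (ideal n))"
  proof (rule close_successive)
    fix j
    show "close ?e
        (bind_pmf (ideal n) (\<lambda>ws. map_pmf (\<lambda>b. (view l ws, take j (V n ?l ws), b))
          (fT (view l ws) j (take j (V n ?l ws)))))
        (map_pmf (\<lambda>ws. (view l ws, take j (V n ?l ws), V n ?l ws ! j)) (ideal n))"
      using close_transmitter_bit[OF assms, of n j]
      by (simp only: fT_def view_def prod.case obs_block diff_Suc_1)
  qed simp
  from close_bind[OF this, of k]
  have 1: "close (2 ^ n * ?e)
      (bind_pmf (bind_pmf (ideal n) (\<lambda>ws. map_pmf (Pair (view l ws)) (successive (fT (view l ws)) ?N))) k)
      (bind_pmf (map_pmf (\<lambda>ws. (view l ws, V n ?l ws)) (ideal n)) k)"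
    by simp
  have "close (real ?N * ?e)
      (bind_pmf (ideal n) (\<lambda>ws. map_pmf (Pair (view l ws, V n ?l ws))
        (successive (fR (view l ws, V n ?l ws)) ?N)))
      (map_pmf (\<lambda>ws. ((view l ws, V n ?l ws), take ?N (V n ?l ws))) (ideal n))"
  proof (rule close_successive)
    fix j assume "j < ?N"
    then show "close ?e
        (bind_pmf (ideal n) (\<lambda>ws. map_pmf (\<lambda>b. ((view l ws, V n ?l ws), take j (V n ?l ws), b))
          (fR (view l ws, V n ?l ws) j (take j (V n ?l ws)))))
        (map_pmf (\<lambda>ws. ((view l ws, V n ?l ws), take j (V n ?l ws), V n ?l ws ! j)) (ideal n))"
      using close_receiver_bit[OF assms(1,2), of j n "\<lambda>ws. (view l ws, V n ?l ws)" ?l]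
      by (simp only: fR_def view_def prod.case obs_block diff_Suc_1)
  qed simp
  then have 2: "close (2 ^ n * ?e)
      (bind_pmf (map_pmf (\<lambda>ws. (view l ws, V n ?l ws)) (ideal n)) k)
      (map_pmf (\<lambda>ws. ((view l ws, V n ?l ws), V n ?l ws)) (ideal n))"
    by (simp add: bind_map_pmf k_def)
  have "bind_pmf (ideal_state n l) (advance n ?l) =
      map_pmf out (bind_pmf (bind_pmf (ideal n)
        (\<lambda>ws. map_pmf (Pair (view l ws)) (successive (fT (view l ws)) ?N))) k)"
    by (simp add: ideal_state_def advance_def round_step_def Let_def k_def out_def fT_def fR_def view_def
        map_pmf_def bind_assoc_pmf bind_return_pmf del: transmitter.simps receiver.simps)
  moreover have "ideal_state n ?l =
      map_pmf out (map_pmf (\<lambda>ws. ((view l ws, V n ?l ws), V n ?l ws)) (ideal n))"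
  proof -
    \<comment> \<open>Transmitter and receiver are the two terminals, so the two updates overwrite
      the whole state.\<close>
    have "(\<lambda>_. u)(?S := u', ?R := u') = (\<lambda>_. u')" for u u' :: "bit list list"
    proof
      fix s show "((\<lambda>_. u)(?S := u', ?R := u')) s = u'" by (cases s) auto
    qed
    then show ?thesis
      unfolding ideal_state_def map_pmf_comp
      by (intro map_pmf_cong refl)
        (simp add: out_def view_def polar_transform_V U_blocks_Suc del: transmitter.simps receiver.simps)
  qed
  ultimately show ?thesis
    using close_map[OF close_trans[OF 1 2], of out] by (simp only: mult_2)
qed

definition state :: "nat \<Rightarrow> nat \<Rightarrow> ('x list \<times> 'y list \<times> (terminal \<Rightarrow> bit list list)) pmf" where
  "state n l = bind_pmf (ideal n) (\<lambda>ws.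
     map_pmf (\<lambda>us. (map X ws, map Y ws, us)) (rounds n (\<lambda>s. map (obs s) ws) l))"

lemma state_Suc: "state n (Suc l) = bind_pmf (state n l) (advance n (Suc l))"
proof -
  have "obs_block (map X ws) (map Y ws) = (\<lambda>s. map (obs s) ws)" for ws
    by (rule ext) (rule obs_block)
  then show ?thesis
    by (simp add: state_def advance_def map_bind_pmf bind_assoc_pmf bind_map_pmf)
qed

lemma close_state:
  assumes "finite (range X)" "finite (range Y)"
    and "\<And>l. 1 \<le> l \<Longrightarrow> l \<le> t \<Longrightarrow>
      \<exists>R. cond_kernel M (\<lambda>\<omega>. (X \<omega>, Y \<omega>)) (side_info (transmitter l) l) (U l) R"
  shows "close (real t * (2 * (2 ^ n * sqrt (delta \<beta> n)))) (state n t) (ideal_state n t)"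
  using assms(3)
proof (induction t)
  case 0
  have "state n 0 = ideal_state n 0"
    by (simp add: state_def ideal_state_def U_blocks_def map_pmf_def bind_return_pmf)
  then show ?case by (simp add: close_refl)
next
  case (Suc t)
  then obtain R where "cond_kernel M (\<lambda>\<omega>. (X \<omega>, Y \<omega>))
      (side_info (transmitter (Suc t)) (Suc t)) (U (Suc t)) R"
    by (metis le_add1 order_refl plus_1_eq_Suc)
  moreover have "close (real t * (2 * (2 ^ n * sqrt (delta \<beta> n)))) (state n t) (ideal_state n t)"
    using Suc by auto
  ultimately have "close (real t * (2 * (2 ^ n * sqrt (delta \<beta> n))) + 2 * (2 ^ n * sqrt (delta \<beta> n)))
      (state n (Suc t)) (ideal_state n (Suc t))"
    unfolding state_Suc by (intro close_trans[OF close_bind close_round[OF assms(1,2)]])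
  then show ?case by (simp add: algebra_simps)
qed

lemma protocol_eq_state:
  "protocol n t = map_pmf (\<lambda>(xs, ys, us). (xs, ys, us TA, us TB)) (state n t)"
  by (simp add: protocol_def state_def map_pmf_def bind_assoc_pmf bind_return_pmf)

text \<open>The bad event is null for ideal blocks, so under the protocol its probability is at most
  the distance of the two laws.\<close>

lemma protocol_failure_le:
  assumes "finite (range X)" "finite (range Y)"
    and "\<And>l. 1 \<le> l \<Longrightarrow> l \<le> t \<Longrightarrow>
      \<exists>R. cond_kernel M (\<lambda>\<omega>. (X \<omega>, Y \<omega>)) (side_info (transmitter l) l) (U l) R"
    and good: "\<And>ws. ws \<in> set_pmf (ideal n) \<Longrightarrow> G (map X ws, map Y ws, U_blocks t ws, U_blocks t ws)"
  shows "1 - measure_pmf.prob (protocol n t) {z. G z} \<le> real t * (2 * (2 ^ n * sqrt (delta \<beta> n)))"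
proof -
  let ?I = "map_pmf (\<lambda>ws. (map X ws, map Y ws, U_blocks t ws, U_blocks t ws)) (ideal n)"
  have "close (real t * (2 * (2 ^ n * sqrt (delta \<beta> n)))) (protocol n t) ?I"
    using close_map[OF close_state[OF assms(1-3), of t n], of "\<lambda>(xs, ys, us). (xs, ys, us TA, us TB)"]
    by (simp add: protocol_eq_state ideal_state_def map_pmf_comp)
  then have "measure_pmf.prob (protocol n t) (- {z. G z}) \<le>
      measure_pmf.prob ?I (- {z. G z}) + real t * (2 * (2 ^ n * sqrt (delta \<beta> n)))"
    by (rule measure_close)
  moreover have "measure_pmf.prob ?I (- {z. G z}) = 0"
    using good by (auto simp: measure_pmf_zero_iff)
  moreover have "measure_pmf.prob (protocol n t) (- {z. G z}) = 1 - measure_pmf.prob (protocol n t) {z. G z}"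
    using measure_pmf.prob_compl[of "{z. G z}" "protocol n t"] by (simp add: Compl_eq_Diff_UNIV)
  ultimately show ?thesis by simp
qed

end

section \<open>Vanishing conditional entropy\<close>

text \<open>Each term of the entropy sum is nonnegative and must vanish. If \<open>T\<close> took
  two values on one fiber of \<open>A\<close>, the joint mass at \<open>w\<close> would be strictly
  below the mass of the fiber, and the term at \<open>w\<close> would be positive.\<close>

lemma cond_entropy_eq_0_imp_function:
  assumes fin: "finite (range T)" "finite (range A)"
    and zero: "cond_entropy M T A = 0"
    and w: "w \<in> set_pmf M" "w' \<in> set_pmf M" "A w' = A w"
  shows "T w' = T w"
proof (rule ccontr)
  assume neq: "T w' \<noteq> T w"
  interpret information_space "measure_pmf M" 2
    by unfold_locales simp
  define q where "q a = measure_pmf.prob M {w. A w = a}" for a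
  define p where "p x = measure_pmf.prob M {w. (T w, A w) = x}" for x
  have A: "simple_function (measure_pmf M) A" and TA: "simple_function (measure_pmf M) (\<lambda>w. (T w, A w))"
    using fin finite_subset[of "range (\<lambda>w. (T w, A w))" "range T \<times> range A"]
    by (auto simp: simple_function_def)
  have "simple_distributed (measure_pmf M) A q"
    by (rule measure_pmf.simple_distributedI[OF A]) (auto simp: q_def vimage_def)
  moreover have "simple_distributed (measure_pmf M) (\<lambda>w. (T w, A w)) p"
    by (rule measure_pmf.simple_distributedI[OF TA]) (auto simp: p_def vimage_def)
  ultimately have "cond_entropy M T A =
      - (\<Sum>(t, a)\<in>range (\<lambda>w. (T w, A w)). p (t, a) * log 2 (p (t, a) / q a))"
    unfolding cond_entropy_def using conditional_entropy_eq by simp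
  with zero have "(\<Sum>(t, a)\<in>range (\<lambda>w. (T w, A w)). - (p (t, a) * log 2 (p (t, a) / q a))) = 0"
    by (simp add: sum_negf case_prod_unfold)
  moreover have "0 \<le> - (p (t, a) * log 2 (p (t, a) / q a))" for t a
  proof (cases "p (t, a) = 0")
    case False
    have "p (t, a) \<le> q a"
      unfolding p_def q_def by (rule measure_pmf.finite_measure_mono) auto
    moreover have "0 < p (t, a)" using False by (simp add: p_def zero_less_measure_iff)
    ultimately have "log 2 (p (t, a) / q a) \<le> log 2 1"
      by (intro log_mono) (auto simp: divide_le_eq)
    with \<open>0 < p (t, a)\<close> show ?thesis by (simp add: mult_le_0_iff)
  qed simp
  moreover have "finite (range (\<lambda>w. (T w, A w)))"
    using TA by (simp add: simple_function_def)
  ultimately have "- (p (T w, A w) * log 2 (p (T w, A w) / q (A w))) = 0"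
    by (subst (asm) sum_nonneg_eq_0_iff) auto
  moreover have pos: "0 < p (T w, A w)"
  proof -
    have "p (T w, A w) \<noteq> 0" using w(1) by (auto simp: p_def measure_pmf_zero_iff)
    then show ?thesis by (simp add: p_def zero_less_measure_iff)
  qed
  moreover have "p (T w, A w) < q (A w)"
  proof -
    have "p (T w, A w) + measure_pmf.prob M {w'} = measure_pmf.prob M ({v. (T v, A v) = (T w, A w)} \<union> {w'})"
      unfolding p_def using neq by (intro measure_pmf.finite_measure_Union[symmetric]) auto
    also have "\<dots> \<le> q (A w)"
      unfolding q_def using w(3) by (intro measure_pmf.finite_measure_mono) auto
    finally show ?thesis
      using pmf_positive[OF w(2)] by (simp add: measure_pmf_single)
  qed
  ultimately show False by (simp add: log_def ln_div)
qed

section \<open>Symbolwise maps in linear time\<close>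

definition symbolwise :: "('a \<Rightarrow> bit list \<Rightarrow> 'z) \<Rightarrow> 'a list \<Rightarrow> bit list list \<Rightarrow> 'z list" where
  "symbolwise \<phi> xs us = map (\<lambda>k. \<phi> (xs ! k) (map (\<lambda>u. u ! k) us)) [0..<length xs]"

lemma length_symbolwise [simp]: "length (symbolwise \<phi> xs us) = length xs"
  by (simp add: symbolwise_def)

text \<open>The decoders are total because transitions are defined on all tape symbols; on a run
  from valid inputs the defaults are never read.\<close>

definition symbol_source :: "('a, 'z) symbol \<Rightarrow> 'a" where
  "symbol_source s = (case s of Src a \<Rightarrow> a | _ \<Rightarrow> undefined)"

definition symbol_bit :: "('a, 'z) symbol \<Rightarrow> bit" where
  "symbol_bit s = (case s of Bit b \<Rightarrow> b | _ \<Rightarrow> 0)"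

text \<open>The \<open>t + 2\<close> tapes hold the source block, the \<open>t\<close> binary blocks
  and the output. All heads move right in lockstep, the finite table of \<open>\<phi>\<close> is
  built into the transitions, and the first blank on the source tape stops the machine.\<close>

definition symbolwise_machine :: "nat \<Rightarrow> ('a \<Rightarrow> bit list \<Rightarrow> 'z) \<Rightarrow> ('a, 'z) machine" where
  "symbolwise_machine t \<phi> =
    \<lparr>tapes = t + 2, states = {0, 1}, start = 0, halt = 1,
     symbols = {Blank} \<union> range Src \<union> range Bit \<union> range Out,
     trans = (\<lambda>_ ss. if hd ss = Blank then (1, map (\<lambda>s. (s, 0)) ss)
       else (0, map (\<lambda>s. (s, 1)) (butlast ss) @
         [(Out (\<phi> (symbol_source (hd ss)) (map symbol_bit (butlast (tl ss)))), 1)]))\<rparr>"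

lemma finite_UNIV_bit: "finite (UNIV :: bit set)"
proof -
  have "(UNIV :: bit set) = {0, 1}" by (auto intro: bit.exhaust)
  then show ?thesis by (metis finite.emptyI finite.insertI)
qed

lemma wf_symbolwise_machine:
  "wf_machine (symbolwise_machine t \<phi> :: ('a::finite, 'z::finite) machine)"
  by (auto simp: wf_machine_def symbolwise_machine_def finite_UNIV_bit dest!: in_set_butlastD)

lemma symbolwise_machine_run:
  fixes \<phi> :: "'a \<Rightarrow> bit list \<Rightarrow> 'z"
  assumes "length us = t" "\<forall>u\<in>set us. length u = length xs" and "k \<le> length xs"
  defines "ins \<equiv> map Src xs # map (map Bit) us"
  shows "(step (symbolwise_machine t \<phi>) ^^ k) (0, map (\<lambda>ss. (contents ss, 0)) (ins @ [[]])) =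
    (0, map (\<lambda>ss. (contents ss, int k)) (ins @ [map Out (take k (symbolwise \<phi> xs us))]))"
  using assms(3)
proof (induction k)
  case (Suc k)
  let ?z = "symbolwise \<phi> xs us"
  have k: "k < length xs" using Suc.prems by simp
  have blank: "contents (map Out (take k ?z)) (int k) = Blank"
    by (simp add: contents_def)
  have src: "contents (map Src xs) (int k) = Src (xs ! k)"
    using k by (simp add: contents_def)
  have bits: "map (\<lambda>u. contents (map Bit u) (int k)) us = map (\<lambda>u. Bit (u ! k)) us"
    using k assms(2) by (auto simp: contents_def)
  have out: "(contents (map Out (take k ?z)))(int k := Out (?z ! k)) = contents (map Out (take (Suc k) ?z))"
    using k by (auto simp: contents_def fun_eq_iff take_Suc_conv_app_nth nth_append)
  have z: "?z ! k = \<phi> (xs ! k) (map (\<lambda>u. u ! k) us)"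
    using k by (simp add: symbolwise_def)
  have heads: "map (\<lambda>(f, h). f h) (map (\<lambda>ss. (contents ss, int k)) (ins @ [map Out (take k ?z)])) =
      Src (xs ! k) # map (\<lambda>u. Bit (u ! k)) us @ [Blank]"
    by (simp add: ins_def src bits blank comp_def)
  have "step (symbolwise_machine t \<phi>)
      (0, map (\<lambda>ss. (contents ss, int k)) (ins @ [map Out (take k ?z)])) =
    (0, map2 (\<lambda>(f, h) (s, d). (f(h := s), h + d))
      (map (\<lambda>ss. (contents ss, int k)) (ins @ [map Out (take k ?z)]))
      (map (\<lambda>s. (s, 1)) (map (\<lambda>ss. contents ss (int k)) ins) @ [(Out (?z ! k), 1)]))"
    unfolding step_def prod.case heads
    by (simp add: symbolwise_machine_def butlast_append z symbol_source_def symbol_bit_def comp_def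
        ins_def src bits)
  also have "\<dots> = (0, map (\<lambda>ss. (contents ss, int (Suc k))) (ins @ [map Out (take (Suc k) ?z)]))"
    by (simp add: out[symmetric] zip_map_map zip_same_conv_map comp_def add.commute)
  finally show ?case using Suc k by simp
qed simp

lemma linear_time_symbolwise:
  fixes \<phi> :: "'a::finite \<Rightarrow> bit list \<Rightarrow> 'z::finite"
  shows "linear_time_block_map t (symbolwise \<phi>)"
  unfolding linear_time_block_map_def
\<comment> \<open>\<open>2 ^ n\<close> steps process the block and one more detects its end; since
  \<open>2 ^ n \<ge> 1\<close>, the factor 2 covers both.\<close>
proof (intro exI[of _ "symbolwise_machine t \<phi>"] exI[of _ 2] conjI allI impI)
  show "wf_machine (symbolwise_machine t \<phi>)" by (rule wf_symbolwise_machine)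
next
  fix n and xs :: "'a list" and us :: "bit list list"
  assume len: "length xs = 2 ^ n \<and> length us = t \<and> (\<forall>u\<in>set us. length u = 2 ^ n)"
  then show "length (symbolwise \<phi> xs us) = 2 ^ n" by simp
  let ?m = "symbolwise_machine t \<phi>" and ?N = "2 ^ n :: nat"
  let ?ins = "map Src xs # map (map Bit) us"
  let ?out = "map Out (symbolwise \<phi> xs us)"
  let ?ts = "map (\<lambda>ss. (contents ss, int ?N)) (?ins @ [?out])"
  have "hd (map (\<lambda>(f, h). f h) ?ts) = Blank"
    using len by (simp add: contents_def)
  moreover have "trans ?m q ss = (1, map (\<lambda>s. (s, 0)) ss)" if "hd ss = Blank" for q ss
    using that by (simp add: symbolwise_machine_def)
  moreover have "halt ?m = 1" by (simp add: symbolwise_machine_def)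
  \<comment> \<open>The halting transition writes back the symbols it reads and moves no
    head.\<close>
  moreover have "map2 (\<lambda>(f, h) (s, d). (f(h := s), h + d)) ts (map (\<lambda>s. (s, 0)) (map (\<lambda>(f, h). f h) ts)) = ts"
    for ts :: "((int \<Rightarrow> ('a, 'z) symbol) \<times> int) list"
    by (induction ts) auto
  ultimately have halt: "step ?m (0, ?ts) = (1, ?ts)"
    by (simp only: step_def prod.case zero_neq_one if_False)
  have stay: "(step ?m ^^ i) (1, ?ts) = (1, ?ts)" for i
    by (induction i) (simp_all add: step_def symbolwise_machine_def)
  \<comment> \<open>The last \<open>?N - 1\<close> steps are spent in the halting state.\<close>
  have "2 * ?N = (?N - 1) + (Suc 0 + ?N)" by simp
  then have "(step ?m ^^ (2 * ?N)) (0, map (\<lambda>ss. (contents ss, 0)) (?ins @ [[]])) =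
      (step ?m ^^ (?N - 1)) (step ?m ((step ?m ^^ ?N) (0, map (\<lambda>ss. (contents ss, 0)) (?ins @ [[]]))))"
    by (simp only: funpow_add comp_def funpow.simps id_apply)
  also have "(step ?m ^^ ?N) (0, map (\<lambda>ss. (contents ss, 0)) (?ins @ [[]])) = (0, ?ts)"
    using len symbolwise_machine_run[of us t xs ?N \<phi>] by simp
  finally have run: "(step ?m ^^ (2 * ?N)) (0, map (\<lambda>ss. (contents ss, 0)) (?ins @ [[]])) = (1, ?ts)"
    by (simp only: halt stay)
  have m: "tapes ?m = Suc (Suc (length us))" "start ?m = 0" "halt ?m = 1"
    using len by (simp_all add: symbolwise_machine_def)
  have init: "?ins @ replicate (tapes ?m - length ?ins) [] = ?ins @ [[]]"
    by (simp add: m)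
  show "computes_within ?m (2 * 2 ^ n) ?ins ?out"
    unfolding computes_within_def Let_def init m(2) run prod.case
    by (simp add: m nth_append)
qed

section \<open>Main result\<close>

text \<open>The square root halves the exponent \<open>N powr \<beta>\<close>. Since
  \<open>\<beta>' < \<beta>\<close>, half of it still outgrows \<open>N powr \<beta>'\<close>
  together with the logarithm of the factor \<open>N\<close>. The estimate is made in a real
  variable and evaluated along \<open>2 ^ n\<close>.\<close>

lemma error_bound_bigo:
  assumes "0 < \<beta>'" "\<beta>' < \<beta>"
  shows "(\<lambda>n. real t * (2 * (2 ^ n * sqrt (delta \<beta> n)))) \<in> O(\<lambda>n. 2 powr - ((2 ^ n) powr \<beta>'))"
proof -
  have "(\<lambda>x :: real. x * sqrt (2 powr - (x powr \<beta>))) \<in> O(\<lambda>x. 2 powr - (x powr \<beta>'))"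
    using assms by real_asymp
  moreover have "filterlim (\<lambda>n. 2 ^ n :: real) at_top sequentially"
    by real_asymp
  ultimately have "(\<lambda>n. 2 ^ n * sqrt (2 powr - ((2 ^ n) powr \<beta>))) \<in> O(\<lambda>n. 2 powr - ((2 ^ n) powr \<beta>'))"
    by (rule landau_o.big.compose)
  then show ?thesis
    by (simp add: delta_def)
qed

context interaction
begin

lemma Us_nth_blocks:
  assumes "k < length ws"
  shows "map (\<lambda>u. u ! k) (U_blocks t ws) = Us t (ws ! k)"
  using assms by (auto simp: U_blocks_def Us_def)

lemma symbolwise_U_blocks:
  assumes "\<And>\<omega>. \<omega> \<in> set ws \<Longrightarrow> \<phi> (S \<omega>) (Us t \<omega>) = f (X \<omega>) (Y \<omega>)"
  shows "symbolwise \<phi> (map S ws) (U_blocks t ws) = map2 f (map X ws) (map Y ws)"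
  by (rule nth_equalityI) (auto simp: symbolwise_def Us_nth_blocks assms)

lemma finite_range_with_Us:
  assumes "finite (range S)"
  shows "finite (range (\<lambda>\<omega>. (S \<omega>, Us t \<omega>)))"
proof (rule finite_subset)
  show "range (\<lambda>\<omega>. (S \<omega>, Us t \<omega>)) \<subseteq> range S \<times> {v. length v \<le> t}"
    by (auto simp: Us_def)
qed (intro finite_SigmaI assms finite_bit_lists)

text \<open>The Markov chain frees the new bit from the other terminal's observation; the
  transmitter's own one can be read off from its side information, so the pair may serve as context.
  \<open>projl\<close> and \<open>projr\<close> undo the tagging by \<open>obs\<close>.\<close>

lemma side_info_cond_kernel:
  assumes "odd l \<Longrightarrow> markov_chain M (U l) (\<lambda>\<omega>. (X \<omega>, Us (l - 1) \<omega>)) Y"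
    and "even l \<Longrightarrow> markov_chain M (U l) (\<lambda>\<omega>. (Y \<omega>, Us (l - 1) \<omega>)) X"
  shows "\<exists>R. cond_kernel M (\<lambda>\<omega>. (X \<omega>, Y \<omega>)) (side_info (transmitter l) l) (U l) R"
proof (cases "odd l")
  case True
  have "cond_kernel M Y (side_info TA l) (U l)
      (\<lambda>a. cond_law undefined M (U l) (\<lambda>\<omega>. (X \<omega>, Us (l - 1) \<omega>)) (apfst projl a))"
    by (rule cond_kernel_reindex[OF markov_chain_cond_kernel[OF assms(1)[OF True]], where f = "apfst Inl"])
      (simp_all add: side_info_def obs_def)
  then have "cond_kernel M (\<lambda>\<omega>. (X \<omega>, Y \<omega>)) (side_info TA l) (U l)
      (\<lambda>a. cond_law undefined M (U l) (\<lambda>\<omega>. (X \<omega>, Us (l - 1) \<omega>)) (apfst projl a))"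
    by (rule cond_kernel_context[where f = "\<lambda>y a. (projl (fst a), y)"])
      (simp add: side_info_def obs_def)
  with True show ?thesis by auto
next
  case False
  then have "even l" by simp
  have "cond_kernel M X (side_info TB l) (U l)
      (\<lambda>a. cond_law undefined M (U l) (\<lambda>\<omega>. (Y \<omega>, Us (l - 1) \<omega>)) (apfst projr a))"
    by (rule cond_kernel_reindex[OF markov_chain_cond_kernel[OF assms(2)[OF \<open>even l\<close>]], where f = "apfst Inr"])
      (simp_all add: side_info_def obs_def)
  then have "cond_kernel M (\<lambda>\<omega>. (X \<omega>, Y \<omega>)) (side_info TB l) (U l)
      (\<lambda>a. cond_law undefined M (U l) (\<lambda>\<omega>. (Y \<omega>, Us (l - 1) \<omega>)) (apfst projr a))"
    by (rule cond_kernel_context[where f = "\<lambda>x a. (x, projr (fst a))"])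
      (simp add: side_info_def obs_def)
  with False show ?thesis by auto
qed

end

lemma function_of_cond_entropy_eq_0:
  assumes "finite (range T)" "finite (range A)" "cond_entropy M T A = 0"
  obtains g where "\<And>w. w \<in> set_pmf M \<Longrightarrow> g (A w) = T w"
proof
  fix w assume "w \<in> set_pmf M"
  \<comment> \<open>On a fiber of \<open>A\<close> that meets the support the value of
    \<open>T\<close> is unique, so the choice picks it.\<close>
  then show "(\<lambda>a. SOME z. \<exists>w\<in>set_pmf M. A w = a \<and> T w = z) (A w) = T w"
    using cond_entropy_eq_0_imp_function[OF assms] by (intro some_equality) blast+
qed

theorem proposition8:
  fixes M :: "'w pmf"
    and X :: "'w \<Rightarrow> 'x::finite"
    and Y :: "'w \<Rightarrow> 'y::finite"
    and U :: "nat \<Rightarrow> 'w \<Rightarrow> bit"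
    and f_A :: "'x \<Rightarrow> 'y \<Rightarrow> 'za::finite"
    and f_B :: "'x \<Rightarrow> 'y \<Rightarrow> 'zb::finite"
    and t :: nat
    and \<beta> \<beta>7 :: real
    and null_d :: "nat \<Rightarrow> nat \<Rightarrow> nat \<Rightarrow> bit list \<Rightarrow> bit pmf"
    and null_i :: "nat \<Rightarrow> nat \<Rightarrow> nat \<Rightarrow> bit list \<times> ('x + 'y) list \<times> bit list list \<Rightarrow> bit pmf"
  assumes "t \<ge> 1"
    and "\<And>i. 1 \<le> i \<Longrightarrow> i \<le> t \<Longrightarrow> odd i \<Longrightarrow>
           markov_chain M (U i) (\<lambda>\<omega>. (X \<omega>, interaction.Us U (i - 1) \<omega>)) Y"
    and "\<And>i. 1 \<le> i \<Longrightarrow> i \<le> t \<Longrightarrow> even i \<Longrightarrow>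
           markov_chain M (U i) (\<lambda>\<omega>. (Y \<omega>, interaction.Us U (i - 1) \<omega>)) X"
    and "cond_entropy M (\<lambda>\<omega>. f_A (X \<omega>) (Y \<omega>)) (\<lambda>\<omega>. (X \<omega>, interaction.Us U t \<omega>)) = 0"
    and "cond_entropy M (\<lambda>\<omega>. f_B (X \<omega>) (Y \<omega>)) (\<lambda>\<omega>. (Y \<omega>, interaction.Us U t \<omega>)) = 0"
    and "0 < \<beta>7" and "\<beta>7 < \<beta>" and "\<beta> < 1 / 2"
  shows "\<exists>(Z_A :: 'x list \<Rightarrow> bit list list \<Rightarrow> 'za list) (Z_B :: 'y list \<Rightarrow> bit list list \<Rightarrow> 'zb list).
     (\<lambda>n. 1 - \<P>((xs, ys, us_A, us_B) in interaction.protocol M X Y U \<beta> null_d null_i n t.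
                 Z_A xs us_A = map2 f_A xs ys))
       \<in> O(\<lambda>n. 2 powr - ((2 ^ n) powr \<beta>7)) \<and>
     (\<lambda>n. 1 - \<P>((xs, ys, us_A, us_B) in interaction.protocol M X Y U \<beta> null_d null_i n t.
                 Z_B ys us_B = map2 f_B xs ys))
       \<in> O(\<lambda>n. 2 powr - ((2 ^ n) powr \<beta>7)) \<and>
     linear_time_block_map t Z_A \<and> linear_time_block_map t Z_B"
proof -
  interpret interaction M X Y U \<beta> null_d null_i .
  have kernel: "\<exists>R. cond_kernel M (\<lambda>\<omega>. (X \<omega>, Y \<omega>)) (side_info (transmitter l) l) (U l) R"
    if "1 \<le> l" "l \<le> t" for l
    using assms(2,3) that by (intro side_info_cond_kernel) auto
  \<comment> \<open>The decoding functions are controlled only on the support of \<open>M\<close>,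
    where every letter of an ideal block lies.\<close>
  have set_ideal: "\<omega> \<in> set_pmf M" if "ws \<in> set_pmf (ideal n)" "\<omega> \<in> set ws" for \<omega> ws n
    using that by (auto simp: ideal_def set_replicate_pmf)
  obtain gA where gA: "\<And>\<omega>. \<omega> \<in> set_pmf M \<Longrightarrow> gA (X \<omega>, Us t \<omega>) = f_A (X \<omega>) (Y \<omega>)"
    using function_of_cond_entropy_eq_0[OF _ finite_range_with_Us assms(4)] by auto
  obtain gB where gB: "\<And>\<omega>. \<omega> \<in> set_pmf M \<Longrightarrow> gB (Y \<omega>, Us t \<omega>) = f_B (X \<omega>) (Y \<omega>)"
    using function_of_cond_entropy_eq_0[OF _ finite_range_with_Us assms(5)] by auto
  let ?ZA = "symbolwise (\<lambda>x bs. gA (x, bs))" and ?ZB = "symbolwise (\<lambda>y bs. gB (y, bs))"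
  \<comment> \<open>\<open>G\<close> stands for correct decoding by either terminal and has to be
    checked on ideal blocks only.\<close>
  have bigo: "(\<lambda>n. 1 - measure_pmf.prob (protocol n t) {z. G z}) \<in> O(\<lambda>n. 2 powr - ((2 ^ n) powr \<beta>7))"
    if "\<And>n ws. ws \<in> set_pmf (ideal n) \<Longrightarrow> G (map X ws, map Y ws, U_blocks t ws, U_blocks t ws)" for G
  proof (rule landau_o.big_trans[OF bigoI error_bound_bigo[OF assms(6,7), of t]])
    show "eventually (\<lambda>n. norm (1 - measure_pmf.prob (protocol n t) {z. G z}) \<le>
        1 * norm (real t * (2 * (2 ^ n * sqrt (delta \<beta> n))))) at_top"
    proof (rule always_eventually, rule allI)
      fix n
      have "1 - measure_pmf.prob (protocol n t) {z. G z} \<le> real t * (2 * (2 ^ n * sqrt (delta \<beta> n)))"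
        by (rule protocol_failure_le) (use kernel that in auto)
      then show "norm (1 - measure_pmf.prob (protocol n t) {z. G z}) \<le>
          1 * norm (real t * (2 * (2 ^ n * sqrt (delta \<beta> n))))"
        using measure_pmf.prob_le_1[of "protocol n t" "{z. G z}"] by simp
    qed
  qed
  have A: "?ZA (map X ws) (U_blocks t ws) = map2 f_A (map X ws) (map Y ws)" if "ws \<in> set_pmf (ideal n)" for n ws
    by (rule symbolwise_U_blocks) (rule gA[OF set_ideal[OF that]])
  have B: "?ZB (map Y ws) (U_blocks t ws) = map2 f_B (map X ws) (map Y ws)" if "ws \<in> set_pmf (ideal n)" for n ws
    by (rule symbolwise_U_blocks) (rule gB[OF set_ideal[OF that]])
  show ?thesis
  proof (intro exI[of _ ?ZA] exI[of _ ?ZB] conjI linear_time_symbolwise)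
    show "(\<lambda>n. 1 - \<P>((xs, ys, us_A, us_B) in protocol n t. ?ZA xs us_A = map2 f_A xs ys))
        \<in> O(\<lambda>n. 2 powr - ((2 ^ n) powr \<beta>7))"
      using bigo[of "\<lambda>(xs, ys, us_A, us_B). ?ZA xs us_A = map2 f_A xs ys"] A by simp
    show "(\<lambda>n. 1 - \<P>((xs, ys, us_A, us_B) in protocol n t. ?ZB ys us_B = map2 f_B xs ys))
        \<in> O(\<lambda>n. 2 powr - ((2 ^ n) powr \<beta>7))"
      using bigo[of "\<lambda>(xs, ys, us_A, us_B). ?ZB ys us_B = map2 f_B xs ys"] B by simp
  qed
qed

end
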